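(* Let $F$ be strongly convex with modulus $\gamma_1>0$. If $L$ possesses a saddle-point, then the sequence $\{(x^k,y^k)\}_{k\ge1}$ generated by the accelerated Douglas--Rachford iteration (aDR) converges to a saddle-point $(x^*,y^* )$ of $L$ in the following sense: $x^k\to x^*$ strongly with $\|x^k-x^*\|^2=O(1/k^2)$, and $y^k\rightharpoonup y^*$ weakly as $k\to\infty$. In particular, each saddle-point $(x',y')$ of $L$ satisfies $x'=x^*$.
   Context: $X,Y$ are real Hilbert spaces, $K:X\to Y$ is linear and continuous with adjoint $K^*$, and $F:X\to(-\infty,\infty]$, $G:Y\to(-\infty,\infty]$ are proper, convex and lower semi-continuous. $L(x,y)=\langle Kx,y\rangle+F(x)-G(y)$ on $\operatorname{dom}F\times\operatorname{dom}G$; a saddle-point is $(x^*,y^* )\in\operatorname{dom}F\times\operatorname{dom}G$ with $L(x^*,y)\le L(x^*,y^* )\le L(x,y^* )$ for all $(x,y)\in\operatorname{dom}F\times\operatorname{dom}G$. $F$ is strongly convex with modulus $\gamma_1$ if $F(\lambda x+(1-\lambda)\bar x)\le\lambda F(x)+(1-\lambda)F(\bar x)-\gamma_1\lambda(1-\lambda)\|x-\bar x\|^2/2$ for all $x,\bar x\in\operatorname{dom}F$, $\lambda\in[0,1]$. Iteration (aDR): choose $(\hat x^0,\hat y^0)\in X\times Y$, $\sigma_0,\tau_0>0$, $0<\gamma<\frac{2\gamma_1}{1+\sigma_0\tau_0\|K\|^2}$, $\vartheta_0=\frac1{\sqrt{1+\sigma_0\gamma}}$, and for $k\ge0$ set $x^{k+1}=(\mathrm{id}+\sigma_k\partial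 F)^{-1}(\hat x^k)$, $y^{k+1}=(\mathrm{id}+\tau_k\partial G)^{-1}(\hat y^k)$, $b^{k+1}=((1+\vartheta_k)x^{k+1}-\vartheta_k\hat x^k)-\sigma_kK^*((1+\vartheta_k)y^{k+1}-\hat y^k)$, $d^{k+1}=(\mathrm{id}+\sigma_0\tau_0K^*K)^{-1}b^{k+1}$, $\hat x^{k+1}=\vartheta_k(\hat x^k-x^{k+1})+d^{k+1}$, $\hat y^{k+1}=y^{k+1}+\vartheta_k^{-1}\tau_kKd^{k+1}$, $\sigma_{k+1}=\vartheta_k\sigma_k$, $\tau_{k+1}=\vartheta_k^{-1}\tau_k$, $\vartheta_{k+1}=\frac1{\sqrt{1+\sigma_{k+1}\gamma}}$. Here $(\mathrm{id}+\sigma\partial F)^{-1}$ denotes the resolvent (proximal map) of the subdifferential. *)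

theory Defs
  imports "HOL-Analysis.Analysis" "HOL-Library.Landau_Symbols"
begin

definition edom :: "('a \<Rightarrow> ereal) \<Rightarrow> 'a set" where
  "edom F = {x. F x < \<infinity>}"

definition proper_fun :: "('a \<Rightarrow> ereal) \<Rightarrow> bool" where
  "proper_fun F \<longleftrightarrow> (\<forall>x. F x \<noteq> -\<infinity>) \<and> edom F \<noteq> {}"

text \<open>The inequalities below are only required between points of the effective domain, where
  a proper function is finite; at other points they hold trivially or, for \<open>l \<in> {0, 1}\<close>, read
  \<open>F x \<le> F x\<close>.\<close>

definition convex_fun :: "('a::real_vector \<Rightarrow> ereal) \<Rightarrow> bool" where
  "convex_fun F \<longleftrightarrow> (\<forall>x\<in>edom F. \<forall>x'\<in>edom F. \<forall>l\<in>{0..1::real}.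
     F (l *\<^sub>R x + (1 - l) *\<^sub>R x') \<le> ereal l * F x + ereal (1 - l) * F x')"

definition strongly_convex_fun :: "real \<Rightarrow> ('a::real_normed_vector \<Rightarrow> ereal) \<Rightarrow> bool" where
  "strongly_convex_fun g F \<longleftrightarrow> (\<forall>x\<in>edom F. \<forall>x'\<in>edom F. \<forall>l\<in>{0..1::real}.
     F (l *\<^sub>R x + (1 - l) *\<^sub>R x') \<le>
       ereal l * F x + ereal (1 - l) * F x' - ereal (g * l * (1 - l) * (norm (x - x'))\<^sup>2 / 2))"

definition lsc_fun :: "('a::topological_space \<Rightarrow> ereal) \<Rightarrow> bool" where
  "lsc_fun F \<longleftrightarrow> (\<forall>x. F x \<le> Liminf (nhds x) F)"

definition subdiff :: "('a::real_inner \<Rightarrow> ereal) \<Rightarrow> 'a \<Rightarrow> 'a set" where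
  "subdiff F x = {p. x \<in> edom F \<and> (\<forall>z. F x + ereal (p \<bullet> (z - x)) \<le> F z)}"

text \<open>The value at \<open>z\<close> of the inverse of the set-valued map \<open>x \<mapsto> x + s T(x)\<close>; for \<open>s > 0\<close> and \<open>T\<close> the
  subdifferential of a proper convex lower semi-continuous function on a Hilbert space, there is
  exactly one such point.\<close>

definition resolvent :: "real \<Rightarrow> ('a::real_vector \<Rightarrow> 'a set) \<Rightarrow> 'a \<Rightarrow> 'a" where
  "resolvent s T z = (THE x. z \<in> (\<lambda>p. x + s *\<^sub>R p) ` T x)"

definition Lagr ::
  "('a::real_inner \<Rightarrow> 'b::real_inner) \<Rightarrow> ('a \<Rightarrow> ereal) \<Rightarrow> ('b \<Rightarrow> ereal) \<Rightarrow> 'a \<Rightarrow> 'b \<Rightarrow> ereal" where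
  "Lagr K F G x y = ereal (K x \<bullet> y) + F x - G y"

definition saddle_point ::
  "('a::real_inner \<Rightarrow> 'b::real_inner) \<Rightarrow> ('a \<Rightarrow> ereal) \<Rightarrow> ('b \<Rightarrow> ereal) \<Rightarrow> 'a \<Rightarrow> 'b \<Rightarrow> bool" where
  "saddle_point K F G xs ys \<longleftrightarrow> xs \<in> edom F \<and> ys \<in> edom G \<and>
     (\<forall>x\<in>edom F. \<forall>y\<in>edom G.
        Lagr K F G xs y \<le> Lagr K F G xs ys \<and> Lagr K F G xs ys \<le> Lagr K F G x ys)"

definition weakly_tendsto :: "(nat \<Rightarrow> 'a::real_normed_vector) \<Rightarrow> 'a \<Rightarrow> bool" where
  "weakly_tendsto u l \<longleftrightarrow>
     (\<forall>f :: 'a \<Rightarrow> real. bounded_linear f \<longrightarrow> (\<lambda>k. f (u k)) \<longlonglongrightarrow> f l)"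

text \<open>The starting data \<open>\<sigma> 0\<close>, \<open>\<tau> 0\<close>, \<open>xh 0\<close>, \<open>yh 0\<close> are free; everything else is determined by
  them, except \<open>x 0\<close>, \<open>y 0\<close>, \<open>b 0\<close>, \<open>d 0\<close>, which are not part of the iteration.\<close>

definition aDR_iteration ::
  "('a::real_inner \<Rightarrow> 'b::real_inner) \<Rightarrow> ('a \<Rightarrow> ereal) \<Rightarrow> ('b \<Rightarrow> ereal) \<Rightarrow> real \<Rightarrow>
   (nat \<Rightarrow> real) \<Rightarrow> (nat \<Rightarrow> real) \<Rightarrow> (nat \<Rightarrow> real) \<Rightarrow>
   (nat \<Rightarrow> 'a) \<Rightarrow> (nat \<Rightarrow> 'b) \<Rightarrow> (nat \<Rightarrow> 'a) \<Rightarrow> (nat \<Rightarrow> 'a) \<Rightarrow> (nat \<Rightarrow> 'a) \<Rightarrow> (nat \<Rightarrow> 'b) \<Rightarrow> bool" where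
  "aDR_iteration K F G \<gamma> \<sigma> \<tau> \<theta> x y b d xh yh \<longleftrightarrow>
     \<theta> 0 = 1 / sqrt (1 + \<sigma> 0 * \<gamma>) \<and>
     (\<forall>k. x (Suc k) = resolvent (\<sigma> k) (subdiff F) (xh k) \<and>
          y (Suc k) = resolvent (\<tau> k) (subdiff G) (yh k) \<and>
          b (Suc k) = ((1 + \<theta> k) *\<^sub>R x (Suc k) - \<theta> k *\<^sub>R xh k)
                        - \<sigma> k *\<^sub>R adjoint K ((1 + \<theta> k) *\<^sub>R y (Suc k) - yh k) \<and>
          d (Suc k) = inv (\<lambda>u. u + (\<sigma> 0 * \<tau> 0) *\<^sub>R adjoint K (K u)) (b (Suc k)) \<and>
          xh (Suc k) = \<theta> k *\<^sub>R (xh k - x (Suc k)) + d (Suc k) \<and>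
          yh (Suc k) = y (Suc k) + (inverse (\<theta> k) * \<tau> k) *\<^sub>R K (d (Suc k)) \<and>
          \<sigma> (Suc k) = \<theta> k * \<sigma> k \<and>
          \<tau> (Suc k) = inverse (\<theta> k) * \<tau> k \<and>
          \<theta> (Suc k) = 1 / sqrt (1 + \<sigma> (Suc k) * \<gamma>))"

end

theory Submission
  imports Defs
begin

text \<open>Put \<open>s = \<sigma>\<^sub>0 \<tau>\<^sub>0\<close>, which equals \<open>\<sigma>\<^sub>k \<tau>\<^sub>k\<close> for every \<open>k\<close>. The step sizes of the two proximal maps change, but the operator
\<open>1 + s K\<^sup>* K\<close> does not, and it is the right preconditioner. In the variables
\<open>a\<^sub>k = (1 + s K\<^sup>* K)\<^sup>-\<^sup>1 (xh\<^sub>k + \<sigma>\<^sub>k K\<^sup>* yh\<^sub>k)\<close> and \<open>c\<^sub>k = yh\<^sub>k - \<tau>\<^sub>k K a\<^sub>k\<close> the iteration becomes an inexact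
proximal point method for the saddle-point operator: with the increments \<open>u\<close>, \<open>v\<close> given by
\<open>a\<^sub>k - a\<^sub>k\<^sub>+\<^sub>1 = \<sigma>\<^sub>k u\<close> and \<open>c\<^sub>k - c\<^sub>k\<^sub>+\<^sub>1 = \<tau>\<^sub>k v\<close>, it reads
\<open>u - K\<^sup>* c\<^sub>k\<^sub>+\<^sub>1 \<in> \<partial>F (a\<^sub>k\<^sub>+\<^sub>1 - s K\<^sup>* v)\<close> and \<open>v + K a\<^sub>k\<^sub>+\<^sub>1 \<in> \<partial>G (c\<^sub>k\<^sub>+\<^sub>1 + s K u)\<close>,
where the arguments of the subdifferentials are exactly \<open>x\<^sub>k\<^sub>+\<^sub>1\<close> and \<open>y\<^sub>k\<^sub>+\<^sub>1\<close>, by the lemma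
\<open>aDR_step_preconditioned\<close>. The locale \<open>accelerated_proximal_scheme\<close> studies this method.

Measure distances by \<open>\<parallel>w\<parallel>\<^sub>s\<^sup>2 = \<parallel>w\<parallel>\<^sup>2 + s \<parallel>K w\<parallel>\<^sup>2\<close> on \<open>X\<close> and by \<open>\<parallel>w\<parallel>\<^sup>2 + s \<parallel>K\<^sup>* w\<parallel>\<^sup>2\<close> on \<open>Y\<close>. In these norms the
cross terms cancel, and the energy
\<open>(\<tau>\<^sub>k / \<sigma>\<^sub>k) \<parallel>a\<^sub>k - x'\<parallel>\<^sub>s\<^sup>2 + \<parallel>c\<^sub>k - y'\<parallel>\<^sub>s\<^sup>2\<close> at a saddle-point \<open>(x', y')\<close> changes in one step by monotonicity terms,
by squares of \<open>u\<close> and \<open>v\<close>, and by \<open>\<gamma> \<tau>\<^sub>k \<parallel>a\<^sub>k\<^sub>+\<^sub>1 - x'\<parallel>\<^sub>s\<^sup>2\<close> with the wrong sign, which is the price of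
\<open>\<tau>\<^sub>k\<^sub>+\<^sub>1 / \<sigma>\<^sub>k\<^sub>+\<^sub>1 = (1 + \<gamma> \<sigma>\<^sub>k) \<tau>\<^sub>k / \<sigma>\<^sub>k\<close>. Strong convexity yields \<open>2 \<gamma>\<^sub>1 \<tau>\<^sub>k \<parallel>x\<^sub>k\<^sub>+\<^sub>1 - x'\<parallel>\<^sup>2\<close>, and the bound on
\<open>\<gamma>\<close> leaves enough room for this to pay the price once \<open>\<tau>\<^sub>k\<close> is large (\<open>energy_descent\<close>).
Since \<open>\<tau>\<^sub>k / \<sigma>\<^sub>k = s / \<sigma>\<^sub>k\<^sup>2\<close> and \<open>\<sigma>\<^sub>k = O(1/k)\<close>, the bounded energy gives the rate for \<open>a\<close>, and its descent gives the
same rate for \<open>v\<close>, hence for \<open>x\<close>; as the limit of \<open>x\<close> is the primal part of an arbitrary saddle-point, that part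
is unique. The descent also gives \<open>u \<rightarrow> 0\<close>.

Weak convergence of \<open>y\<close> is Opial's argument. Weak cluster points of \<open>c\<close> are dual solutions because
subdifferentials are demiclosed (\<open>weak_cluster_point_kkt\<close>). As the primal solution is unique, the
energies at two dual solutions have the same first summand; their difference is affine in \<open>c\<^sub>k\<close> and
converges, so that there is only one cluster point (\<open>weak_cluster_point_unique\<close>).\<close>

section \<open>Convex functions and their subdifferentials\<close>

lemma real_on_edom:
  assumes "proper_fun F" "x \<in> edom F"
  shows "\<exists>r. F x = ereal r"
  using assms unfolding proper_fun_def edom_def by (cases "F x") auto

lemma convex_fun_iff_strongly_convex_0: "convex_fun F \<longleftrightarrow> strongly_convex_fun 0 F"
  unfolding convex_fun_def strongly_convex_fun_def by simp

lemma strongly_convex_funD: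
  assumes "proper_fun F" "strongly_convex_fun g F" "F x = ereal r" "F x' = ereal r'" "0 \<le> l" "l \<le> 1"
  shows "F (l *\<^sub>R x + (1 - l) *\<^sub>R x') \<le> ereal (l * r + (1 - l) * r' - g * l * (1 - l) * (norm (x - x'))\<^sup>2 / 2)"
proof -
  have "x \<in> edom F" "x' \<in> edom F" using assms by (auto simp: edom_def)
  then have "F (l *\<^sub>R x + (1 - l) *\<^sub>R x') \<le>
       ereal l * F x + ereal (1 - l) * F x' - ereal (g * l * (1 - l) * (norm (x - x'))\<^sup>2 / 2)"
    using assms(2,5,6) unfolding strongly_convex_fun_def by auto
  then show ?thesis using assms(3,4) by simp
qed

lemma lsc_fun_eventually:
  assumes "lsc_fun F" "ereal m < F p"
  shows "eventually (\<lambda>x. ereal m < F x) (nhds p)"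
  using assms less_LiminfD[of "ereal m" "nhds p" F] unfolding lsc_fun_def by (meson less_le_trans)

text \<open>Near a point \<open>x0\<close> of the domain, lower semi-continuity bounds \<open>F\<close> from below. By convexity on the segment
from \<open>x0\<close> to a far point \<open>x\<close>, a very small value at \<open>x\<close> would force a value below that bound
inside the neighbourhood. This gives a minorant of linear growth, which the quadratic term of
the proximal map dominates, without separating hyperplanes.\<close>

lemma convex_lsc_lower_bound:
  fixes F :: "'a::real_normed_vector \<Rightarrow> ereal"
  assumes pr: "proper_fun F" and cv: "convex_fun F" and ls: "lsc_fun F"
  obtains x0 m L where "L \<ge> 0" "\<And>x. ereal (m - L * norm (x - x0)) \<le> F x"
proof -
  obtain x0 where "x0 \<in> edom F" using pr by (auto simp: proper_fun_def)
  then obtain r0 where r0: "F x0 = ereal r0" using real_on_edom[OF pr] by metis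
  then have "eventually (\<lambda>x. ereal (r0 - 1) < F x) (nhds x0)"
    by (intro lsc_fun_eventually ls) auto
  then obtain e where e: "e > 0" "\<And>x. dist x x0 < e \<Longrightarrow> ereal (r0 - 1) < F x"
    unfolding eventually_nhds_metric by blast
  define \<delta> where "\<delta> = e / 2"
  have \<delta>: "\<delta> > 0" "\<delta> < e" using e by (auto simp: \<delta>_def)
  have "ereal (r0 - 1 - (1 / \<delta>) * norm (x - x0)) \<le> F x" for x
  proof (cases "F x = \<infinity>")
    case False
    then obtain r where r: "F x = ereal r" using real_on_edom[OF pr, of x] by (auto simp: edom_def)
    show ?thesis
    proof (cases "norm (x - x0) \<le> \<delta>")
      case True
      then have "ereal (r0 - 1) < F x" using e(2)[of x] \<delta> by (simp add: dist_norm)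
      moreover have "(1 / \<delta>) * norm (x - x0) \<ge> 0" using \<delta> by simp
      ultimately show ?thesis using r by simp
    next
      case far: False
      define l where "l = \<delta> / norm (x - x0)"
      have n: "norm (x - x0) > 0" using far \<delta> by linarith
      have l: "0 < l" "l \<le> 1" using far \<delta> by (auto simp: l_def divide_simps)
      let ?w = "l *\<^sub>R x + (1 - l) *\<^sub>R x0"
      have "?w - x0 = l *\<^sub>R (x - x0)" by (simp add: algebra_simps)
      then have "dist ?w x0 = \<delta>" using n \<delta> by (simp add: dist_norm l_def)
      then have "ereal (r0 - 1) < F ?w" using e(2) \<delta> by simp
      also have "F ?w \<le> ereal (l * r + (1 - l) * r0 - 0 * l * (1 - l) * (norm (x - x0))\<^sup>2 / 2)"
        using cv r r0 l by (intro strongly_convex_funD pr) (auto simp: convex_fun_iff_strongly_convex_0)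
      finally have "l * (r0 - r) < 1" by (simp add: algebra_simps)
      then have "r0 - r < 1 / l" using l by (simp add: field_simps)
      also have "1 / l = (1 / \<delta>) * norm (x - x0)" by (simp add: l_def)
      finally show ?thesis using r by simp
    qed
  qed simp
  then show ?thesis using that[of "1 / \<delta>" "r0 - 1" x0] \<delta> by simp
qed

lemma subdiff_monotone:
  assumes "proper_fun F" "p \<in> subdiff F x" "q \<in> subdiff F z"
  shows "(p - q) \<bullet> (x - z) \<ge> 0"
proof -
  have d: "x \<in> edom F" "z \<in> edom F" using assms by (auto simp: subdiff_def)
  obtain r r' where r: "F x = ereal r" "F z = ereal r'" using d real_on_edom[OF assms(1)] by metis
  have "r + p \<bullet> (z - x) \<le> r'" "r' + q \<bullet> (x - z) \<le> r"
    using assms(2,3) r unfolding subdiff_def by (force dest: spec[of _ z], force dest: spec[of _ x])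
  then show ?thesis by (simp add: inner_diff_left inner_diff_right)
qed

text \<open>Apply the subgradient inequality at \<open>x + t (z - x)\<close>, divide by \<open>t\<close> and let \<open>t\<close> tend to \<open>0\<close>.\<close>

lemma subdiff_quadratic_lower_bound:
  assumes pr: "proper_fun F" and sc: "strongly_convex_fun g F" and p: "p \<in> subdiff F x"
    and r: "F x = ereal r" "F z = ereal r'"
  shows "r + p \<bullet> (z - x) + g / 2 * (norm (z - x))\<^sup>2 \<le> r'"
proof -
  have *: "r + p \<bullet> (z - x) + g * (1 - t) / 2 * (norm (z - x))\<^sup>2 \<le> r'" if t: "0 < t" "t < 1" for t
  proof -
    have "F (t *\<^sub>R z + (1 - t) *\<^sub>R x) \<le> ereal (t * r' + (1 - t) * r - g * t * (1 - t) * (norm (z - x))\<^sup>2 / 2)"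
      using t r by (intro strongly_convex_funD pr sc) auto
    moreover have "F x + ereal (p \<bullet> ((t *\<^sub>R z + (1 - t) *\<^sub>R x) - x)) \<le> F (t *\<^sub>R z + (1 - t) *\<^sub>R x)"
      using p by (auto simp: subdiff_def)
    moreover have "(t *\<^sub>R z + (1 - t) *\<^sub>R x) - x = t *\<^sub>R (z - x)" by (simp add: algebra_simps)
    ultimately have "ereal (r + t * (p \<bullet> (z - x))) \<le> ereal (t * r' + (1 - t) * r - g * t * (1 - t) * (norm (z - x))\<^sup>2 / 2)"
      using r by (metis (no_types, lifting) inner_scaleR_right order_trans plus_ereal.simps(1))
    then have "t * (r + p \<bullet> (z - x) + g * (1 - t) / 2 * (norm (z - x))\<^sup>2) \<le> t * r'"
      by (simp add: algebra_simps)
    then show ?thesis using t by simp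
  qed
  have "((\<lambda>t. r + p \<bullet> (z - x) + g * (1 - t) / 2 * (norm (z - x))\<^sup>2) \<longlongrightarrow> r + p \<bullet> (z - x) + g * (1 - 0) / 2 * (norm (z - x))\<^sup>2) (at_right 0)"
    by (intro tendsto_intros) auto
  moreover have "eventually (\<lambda>t. r + p \<bullet> (z - x) + g * (1 - t) / 2 * (norm (z - x))\<^sup>2 \<le> r') (at_right 0)"
    using * unfolding eventually_at_right_field by (intro exI[of _ 1]) auto
  ultimately show ?thesis using tendsto_upperbound[of _ _ "at_right (0::real)" r'] by fastforce
qed

lemma subdiff_strongly_monotone:
  assumes pr: "proper_fun F" and sc: "strongly_convex_fun g F"
    and p: "p \<in> subdiff F x" and q: "q \<in> subdiff F z"
  shows "g * (norm (x - z))\<^sup>2 \<le> (p - q) \<bullet> (x - z)"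
proof -
  have d: "x \<in> edom F" "z \<in> edom F" using assms by (auto simp: subdiff_def)
  obtain r r' where r: "F x = ereal r" "F z = ereal r'" using d real_on_edom[OF pr] by metis
  show ?thesis
    using subdiff_quadratic_lower_bound[OF pr sc p r] subdiff_quadratic_lower_bound[OF pr sc q r(2,1)]
    by (simp add: inner_diff_left inner_diff_right norm_minus_commute field_simps)
qed

lemma parallelogram_midpoint:
  fixes x w z :: "'a::real_inner"
  shows "(norm ((1/2) *\<^sub>R x + (1/2) *\<^sub>R w - z))\<^sup>2
    = (norm (x - z))\<^sup>2 / 2 + (norm (w - z))\<^sup>2 / 2 - (norm (x - w))\<^sup>2 / 4"
  by (simp add: power2_norm_eq_inner inner_diff_left inner_diff_right inner_add_left inner_add_right
      inner_commute field_simps)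

text \<open>The point is the minimiser of \<open>F + \<parallel>\<cdot> - z\<parallel>\<^sup>2 / (2 s)\<close>. By the parallelogram law the objective at a midpoint
lies below the average by a multiple of the squared distance, so minimising sequences are
Cauchy, and lower semi-continuity turns their limit into a minimiser.\<close>

lemma proximal_point_exists:
  fixes F :: "'a::{real_inner, complete_space} \<Rightarrow> ereal"
  assumes pr: "proper_fun F" and cv: "convex_fun F" and ls: "lsc_fun F" and s: "s > 0"
  shows "\<exists>p. (1 / s) *\<^sub>R (z - p) \<in> subdiff F p"
proof -
  obtain x0 m0 L where L: "L \<ge> 0" and lb: "\<And>x. ereal (m0 - L * norm (x - x0)) \<le> F x"
    using convex_lsc_lower_bound[OF pr cv ls] by metis
  define f where "f x = real_of_ereal (F x)" for x
  have Ff: "F x = ereal (f x)" if "x \<in> edom F" for x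
    using real_on_edom[OF pr that] by (auto simp: f_def)
  define \<phi> where "\<phi> x = f x + (norm (x - z))\<^sup>2 / (2 * s)" for x
  have flb: "f x \<ge> m0 - L * norm (x - x0)" if "x \<in> edom F" for x using lb[of x] Ff[OF that] by simp
  have bdd: "bdd_below (\<phi> ` edom F)"
  proof (rule bdd_belowI2)
    fix x assume "x \<in> edom F"
    have "L * norm (x - x0) \<le> L * (norm (x - z) + norm (z - x0))"
      using L norm_triangle_ineq[of "x - z" "z - x0"] by (intro mult_left_mono) auto
    \<comment> \<open>completing the square: the quadratic term absorbs the linear minorant\<close>
    moreover have "0 \<le> (norm (x - z) - s * L)\<^sup>2 / (2 * s)" using s by simp
    moreover have "(norm (x - z) - s * L)\<^sup>2 / (2 * s) = (norm (x - z))\<^sup>2 / (2 * s) - L * norm (x - z) + s * L\<^sup>2 / 2"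
      using s by (simp add: field_simps power2_eq_square)
    ultimately show "m0 - L * norm (z - x0) - s * L\<^sup>2 / 2 \<le> \<phi> x"
      using flb[OF \<open>x \<in> edom F\<close>] by (simp add: \<phi>_def algebra_simps)
  qed
  define m where "m = Inf (\<phi> ` edom F)"
  have ne: "edom F \<noteq> {}" using pr by (simp add: proper_fun_def)
  have m_le: "m \<le> \<phi> x" if "x \<in> edom F" for x using bdd that by (auto simp: m_def intro: cInf_lower)
  have "\<exists>x\<in>edom F. \<phi> x < m + 1 / real (Suc n)" for n
  proof -
    have "Inf (\<phi> ` edom F) < m + 1 / real (Suc n)" by (simp add: m_def)
    then show ?thesis using cInf_lessD[of "\<phi> ` edom F"] ne by blast
  qed
  then obtain X where X: "\<And>n. X n \<in> edom F" "\<And>n. \<phi> (X n) < m + 1 / real (Suc n)" by metis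
  have mid: "(norm (x - w))\<^sup>2 \<le> 8 * s * ((\<phi> x - m) / 2 + (\<phi> w - m) / 2)"
    if xw: "x \<in> edom F" "w \<in> edom F" for x w
  proof -
    let ?c = "(1/2) *\<^sub>R x + (1/2) *\<^sub>R w"
    have "F ((1/2) *\<^sub>R x + (1 - 1/2) *\<^sub>R w) \<le> ereal ((1/2) * f x + (1 - 1/2) * f w - 0 * (1/2) * (1 - 1/2) * (norm (x - w))\<^sup>2 / 2)"
      using cv Ff xw by (intro strongly_convex_funD pr) (auto simp: convex_fun_iff_strongly_convex_0)
    then have le: "F ?c \<le> ereal ((f x + f w) / 2)" by (simp add: field_simps)
    then have "?c \<in> edom F" using less_ereal.simps(2) unfolding edom_def by (auto intro: le_less_trans)
    then have "f ?c \<le> (f x + f w) / 2" "m \<le> \<phi> ?c" using le Ff m_le by auto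
    then have "m \<le> (f x + f w) / 2 + (norm (?c - z))\<^sup>2 / (2 * s)" unfolding \<phi>_def by linarith
    also have "(norm (?c - z))\<^sup>2 / (2 * s)
        = ((norm (x - z))\<^sup>2 / (2 * s) + (norm (w - z))\<^sup>2 / (2 * s)) / 2 - (norm (x - w))\<^sup>2 / (8 * s)"
      unfolding parallelogram_midpoint by (simp add: diff_divide_distrib add_divide_distrib)
    finally have "(norm (x - w))\<^sup>2 / (8 * s) \<le> (\<phi> x - m) / 2 + (\<phi> w - m) / 2"
      unfolding \<phi>_def by argo
    then show ?thesis using s by (simp add: divide_le_eq mult.commute)
  qed
  have "Cauchy X"
  proof (rule metric_CauchyI)
    fix e :: real assume e: "e > 0"
    obtain M where M: "8 * s / e\<^sup>2 < real M" using reals_Archimedean2 by blast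
    have "dist (X i) (X j) < e" if ij: "i \<ge> M" "j \<ge> M" for i j
    proof -
      have "1 / real (Suc i) \<le> 1 / real (Suc M)" "1 / real (Suc j) \<le> 1 / real (Suc M)"
        using ij by (auto simp: field_simps)
      then have "(\<phi> (X i) - m) / 2 + (\<phi> (X j) - m) / 2 \<le> 1 / real (Suc M)"
        using X(2)[of i] X(2)[of j] by argo
      then have "(norm (X i - X j))\<^sup>2 \<le> 8 * s * (1 / real (Suc M))"
        using mid[OF X(1) X(1), of i j] s by (smt (verit) mult_left_mono)
      also have "\<dots> < e\<^sup>2" using M e by (simp add: field_simps) (smt (verit) zero_less_power)
      finally show ?thesis using e by (simp add: dist_norm power2_less_imp_less)
    qed
    then show "\<exists>M. \<forall>m\<ge>M. \<forall>n\<ge>M. dist (X m) (X n) < e" by blast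
  qed
  then obtain p where p: "X \<longlonglongrightarrow> p" using Cauchy_convergent convergent_def by blast
  have Fp: "F p \<le> ereal (m - (norm (p - z))\<^sup>2 / (2 * s))"
  proof (rule ccontr)
    assume "\<not> ?thesis"
    then obtain c where c: "ereal (m - (norm (p - z))\<^sup>2 / (2 * s)) < ereal c" "ereal c < F p"
      by (metis ereal_dense2 not_le)
    have "eventually (\<lambda>n. ereal c < F (X n)) sequentially"
      using lsc_fun_eventually[OF ls c(2)] p by (rule eventually_compose_filterlim)
    then have ev: "eventually (\<lambda>n. c + (norm (X n - z))\<^sup>2 / (2 * s) \<le> m + 1 / real (Suc n)) sequentially"
    proof eventually_elim
      case (elim n)
      then show ?case using X(2)[of n] Ff[OF X(1)[of n]] by (simp add: \<phi>_def)
    qed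
    have "(\<lambda>n. c + (norm (X n - z))\<^sup>2 / (2 * s)) \<longlonglongrightarrow> c + (norm (p - z))\<^sup>2 / (2 * s)"
      by (intro tendsto_intros p) (use s in auto)
    moreover have "(\<lambda>n. m + 1 / real (Suc n)) \<longlonglongrightarrow> m + 0"
      using LIMSEQ_inverse_real_of_nat by (intro tendsto_intros) (simp add: inverse_eq_divide)
    ultimately have "c + (norm (p - z))\<^sup>2 / (2 * s) \<le> m + 0"
      using ev by (intro tendsto_le[of sequentially]) auto
    then show False using c(1) by simp
  qed
  then have pD: "p \<in> edom F" using less_ereal.simps(2) unfolding edom_def by (auto intro: le_less_trans)
  have \<phi>p: "\<phi> p \<le> m" using Fp Ff[OF pD] by (simp add: \<phi>_def)
  \<comment> \<open>Fermat's rule: compare \<open>p\<close> with \<open>p + t (w - p)\<close> and let \<open>t\<close> tend to \<open>0\<close>\<close>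
  have "F p + ereal (((1 / s) *\<^sub>R (z - p)) \<bullet> (w - p)) \<le> F w" for w
  proof (cases "w \<in> edom F")
    case True
    have *: "f p + ((1 / s) *\<^sub>R (z - p)) \<bullet> (w - p) - t * (norm (w - p))\<^sup>2 / (2 * s) \<le> f w" if t: "0 < t" "t < 1" for t
    proof -
      let ?c = "t *\<^sub>R w + (1 - t) *\<^sub>R p"
      have le: "F ?c \<le> ereal (t * f w + (1 - t) * f p - 0 * t * (1 - t) * (norm (w - p))\<^sup>2 / 2)"
        using cv Ff True pD t by (intro strongly_convex_funD pr) (auto simp: convex_fun_iff_strongly_convex_0)
      then have "?c \<in> edom F" using less_ereal.simps(2) unfolding edom_def by (auto intro: le_less_trans)
      then have 1: "f ?c \<le> t * f w + (1 - t) * f p" "\<phi> p \<le> \<phi> ?c" using le Ff m_le \<phi>p by (auto intro: order_trans)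
      have "?c - z = (p - z) + t *\<^sub>R (w - p)" by (simp add: algebra_simps)
      then have 2: "(norm (?c - z))\<^sup>2 = (norm (p - z))\<^sup>2 + 2 * t * ((p - z) \<bullet> (w - p)) + t\<^sup>2 * (norm (w - p))\<^sup>2"
        by (simp only: power2_norm_eq_inner)
           (simp add: inner_add_left inner_add_right inner_commute power2_eq_square algebra_simps)
      have "f p + (norm (p - z))\<^sup>2 / (2 * s) \<le> t * f w + (1 - t) * f p + (norm (?c - z))\<^sup>2 / (2 * s)"
        using 1 by (simp add: \<phi>_def)
      also have "(norm (?c - z))\<^sup>2 / (2 * s)
          = (norm (p - z))\<^sup>2 / (2 * s) + t * ((p - z) \<bullet> (w - p) / s) + t * (t * (norm (w - p))\<^sup>2 / (2 * s))"
        unfolding 2 by (simp add: add_divide_distrib power2_eq_square)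
      finally have "0 \<le> t * (f w - f p + (p - z) \<bullet> (w - p) / s + t * (norm (w - p))\<^sup>2 / (2 * s))"
        by (simp add: distrib_left right_diff_distrib left_diff_distrib)
      then have "0 \<le> f w - f p + (p - z) \<bullet> (w - p) / s + t * (norm (w - p))\<^sup>2 / (2 * s)"
        using t by (simp add: zero_le_mult_iff)
      then show ?thesis by (simp add: inner_diff_left diff_divide_distrib)
    qed
    have "((\<lambda>t. f p + ((1 / s) *\<^sub>R (z - p)) \<bullet> (w - p) - t * (norm (w - p))\<^sup>2 / (2 * s)) \<longlongrightarrow>
       f p + ((1 / s) *\<^sub>R (z - p)) \<bullet> (w - p) - 0 * (norm (w - p))\<^sup>2 / (2 * s)) (at_right 0)"
      by (intro tendsto_intros) (use s in auto)
    moreover have "eventually (\<lambda>t. f p + ((1 / s) *\<^sub>R (z - p)) \<bullet> (w - p) - t * (norm (w - p))\<^sup>2 / (2 * s) \<le> f w) (at_right 0)"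
      using * unfolding eventually_at_right_field by (intro exI[of _ 1]) auto
    ultimately have "f p + ((1 / s) *\<^sub>R (z - p)) \<bullet> (w - p) \<le> f w"
      using tendsto_upperbound[of _ _ "at_right (0::real)" "f w"] by fastforce
    then show ?thesis using Ff True pD by simp
  qed (simp add: edom_def)
  then show ?thesis using pD by (auto simp: subdiff_def)
qed

lemma resolvent_subdiff:
  fixes F :: "'a::{real_inner, complete_space} \<Rightarrow> ereal"
  assumes pr: "proper_fun F" and cv: "convex_fun F" and ls: "lsc_fun F" and s: "s > 0"
  shows "(1 / s) *\<^sub>R (z - resolvent s (subdiff F) z) \<in> subdiff F (resolvent s (subdiff F) z)"
proof -
  obtain p where p: "(1 / s) *\<^sub>R (z - p) \<in> subdiff F p"
    using proximal_point_exists[OF assms] by blast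
  have "resolvent s (subdiff F) z = p"
    unfolding resolvent_def
  proof (rule the_equality)
    show "z \<in> (\<lambda>q. p + s *\<^sub>R q) ` subdiff F p" using p s by (intro image_eqI[OF _ p]) auto
    fix x assume "z \<in> (\<lambda>q. x + s *\<^sub>R q) ` subdiff F x"
    then obtain q where q: "q \<in> subdiff F x" "z = x + s *\<^sub>R q" by auto
    have "0 \<le> ((1 / s) *\<^sub>R (z - p) - q) \<bullet> (p - x)" by (rule subdiff_monotone[OF pr p q(1)])
    also have "(1 / s) *\<^sub>R (z - p) - q = (1 / s) *\<^sub>R (x - p)"
      using q(2) s by (simp add: algebra_simps)
    also have "\<dots> \<bullet> (p - x) = - ((p - x) \<bullet> (p - x)) / s"
      by (simp add: inner_diff_left inner_diff_right inner_commute flip: minus_divide_left diff_divide_distrib)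
    finally have "(p - x) \<bullet> (p - x) \<le> 0" using s by (simp add: divide_le_0_iff)
    then have "(p - x) \<bullet> (p - x) = 0" by (intro antisym) auto
    then show "x = p" by simp
  qed
  then show ?thesis using p by simp
qed

text \<open>Minty's trick. The pair \<open>(r, x' + p' - r)\<close>, where \<open>r\<close> is the resolvent at \<open>x' + p'\<close>, lies on the graph of
the subdifferential. Monotonicity against it survives the limit and reads
\<open>0 \<le> - \<parallel>x' - r\<parallel>\<^sup>2\<close>. Only convergence of the pairing \<open>p \<bullet> x\<close> is required beyond weak convergence, so the
same lemma serves the primal side (\<open>x\<close> strong, \<open>p\<close> weak) and the dual side (\<open>x\<close> weak, \<open>p\<close> strong).
Limits are along a filter, since weak cluster points are produced as filters below.\<close>

lemma subdiff_demiclosed: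
  fixes F :: "'a::{real_inner, complete_space} \<Rightarrow> ereal"
  assumes pr: "proper_fun F" and cv: "convex_fun F" and ls: "lsc_fun F" and H: "H \<noteq> bot"
    and sub: "eventually (\<lambda>k. p k \<in> subdiff F (x k)) H"
    and x: "\<And>w. ((\<lambda>k. x k \<bullet> w) \<longlongrightarrow> x' \<bullet> w) H"
    and p: "\<And>w. ((\<lambda>k. p k \<bullet> w) \<longlongrightarrow> p' \<bullet> w) H"
    and px: "((\<lambda>k. p k \<bullet> x k) \<longlongrightarrow> p' \<bullet> x') H"
  shows "p' \<in> subdiff F x'"
proof -
  define r where "r = resolvent 1 (subdiff F) (x' + p')"
  have r: "x' + p' - r \<in> subdiff F r"
    using resolvent_subdiff[OF pr cv ls, of 1 "x' + p'"] by (simp add: r_def)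
  let ?e = "x' + p' - r"
  have "((\<lambda>k. p k \<bullet> x k - p k \<bullet> r - (x k \<bullet> ?e - ?e \<bullet> r)) \<longlongrightarrow> p' \<bullet> x' - p' \<bullet> r - (x' \<bullet> ?e - ?e \<bullet> r)) H"
    by (intro tendsto_intros x p px)
  moreover have "eventually (\<lambda>k. 0 \<le> p k \<bullet> x k - p k \<bullet> r - (x k \<bullet> ?e - ?e \<bullet> r)) H"
    using sub
  proof eventually_elim
    case (elim k)
    from subdiff_monotone[OF pr elim r] show ?case
      by (simp add: inner_diff_left inner_diff_right inner_add_left inner_add_right inner_commute)
  qed
  ultimately have "0 \<le> p' \<bullet> x' - p' \<bullet> r - (x' \<bullet> ?e - ?e \<bullet> r)"
    using H by (intro tendsto_lowerbound)
  also have "\<dots> = - ((x' - r) \<bullet> (x' - r))"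
    by (simp add: inner_diff_left inner_diff_right inner_add_left inner_add_right inner_commute)
  finally have "(x' - r) \<bullet> (x' - r) = 0" by (intro antisym) auto
  then have "x' = r" by simp
  then show ?thesis using r by simp
qed

section \<open>Hilbert space tools\<close>

text \<open>The representing vector minimises \<open>\<parallel>u\<parallel>\<^sup>2 / 2 + s \<parallel>K u\<parallel>\<^sup>2 / 2 - f u\<close>, that is, it is a proximal
point at \<open>0\<close>. For \<open>K = 0\<close> this is the Riesz representation theorem, which provides the adjoint; for
\<open>f = (\<bullet>) b\<close> it solves \<open>u + s K\<^sup>* K u = b\<close>.\<close>

lemma energy_riesz:
  fixes K :: "'a::{real_inner, complete_space} \<Rightarrow> 'b::real_inner" and f :: "'a \<Rightarrow> real"
  assumes K: "bounded_linear K" and f: "bounded_linear f" and s: "s \<ge> 0"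
  shows "\<exists>u. \<forall>w. u \<bullet> w + s * (K u \<bullet> K w) = f w"
proof -
  interpret K: bounded_linear K by fact
  interpret f: bounded_linear f by fact
  define g where "g u = s / 2 * (norm (K u))\<^sup>2 - f u" for u
  define F where "F u = ereal (g u)" for u
  have pr: "proper_fun F" by (auto simp: proper_fun_def F_def edom_def)
  have "continuous_on UNIV g" unfolding g_def
    by (intro continuous_intros K.continuous_on f.continuous_on)
  then have "(g \<longlongrightarrow> g x) (nhds x)" for x
    by (metis continuous_on_def UNIV_I tendsto_at_iff_tendsto_nhds)
  then have "(F \<longlongrightarrow> F x) (nhds x)" for x unfolding F_def by simp
  then have ls: "lsc_fun F" unfolding lsc_fun_def by (metis lim_imp_Liminf nhds_neq_bot order_refl)
  have cv: "convex_fun F"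
    unfolding convex_fun_def
  proof (intro ballI)
    fix x x' and l :: real assume l: "l \<in> {0..1}"
    have "l * g x + (1 - l) * g x' - g (l *\<^sub>R x + (1 - l) *\<^sub>R x') = s / 2 * l * (1 - l) * (norm (K x - K x'))\<^sup>2"
      unfolding g_def K.add K.scaleR f.add f.scaleR power2_norm_eq_inner
      by (simp add: inner_diff_left inner_diff_right inner_add_left inner_add_right inner_commute field_simps)
    also have "\<dots> \<ge> 0" using l s by simp
    finally show "F (l *\<^sub>R x + (1 - l) *\<^sub>R x') \<le> ereal l * F x + ereal (1 - l) * F x'" by (simp add: F_def)
  qed
  obtain u where u: "(1 / 1) *\<^sub>R (0 - u) \<in> subdiff F u"
    using proximal_point_exists[OF pr cv ls, of 1 0] by auto
  have le: "f w \<le> u \<bullet> w + s * (K u \<bullet> K w)" for w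
  proof -
    have *: "f w \<le> u \<bullet> w + s * (K u \<bullet> K w) + t * (s / 2 * (norm (K w))\<^sup>2)" if "t > 0" for t
    proof -
      have "g u - u \<bullet> ((u + t *\<^sub>R w) - u) \<le> g (u + t *\<^sub>R w)"
        using u unfolding subdiff_def F_def by (auto dest: spec[of _ "u + t *\<^sub>R w"])
      then have "0 \<le> t * (u \<bullet> w + s * (K u \<bullet> K w) + t * (s / 2 * (norm (K w))\<^sup>2) - f w)"
        unfolding g_def K.add K.scaleR f.add f.scaleR power2_norm_eq_inner
        by (simp add: inner_add_left inner_add_right inner_commute field_simps)
      then show ?thesis using that by (simp add: zero_le_mult_iff)
    qed
    have "((\<lambda>t. u \<bullet> w + s * (K u \<bullet> K w) + t * (s / 2 * (norm (K w))\<^sup>2)) \<longlongrightarrow> u \<bullet> w + s * (K u \<bullet> K w) + 0 * (s / 2 * (norm (K w))\<^sup>2)) (at_right 0)"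
      by (intro tendsto_intros)
    moreover have "eventually (\<lambda>t. f w \<le> u \<bullet> w + s * (K u \<bullet> K w) + t * (s / 2 * (norm (K w))\<^sup>2)) (at_right 0)"
      using eventually_at_right_less[of "0::real"] by (rule eventually_mono) (rule *)
    ultimately have "f w \<le> u \<bullet> w + s * (K u \<bullet> K w) + 0 * (s / 2 * (norm (K w))\<^sup>2)"
      by (intro tendsto_lowerbound) auto
    then show ?thesis by simp
  qed
  have "u \<bullet> w + s * (K u \<bullet> K w) = f w" for w
    using le[of w] le[of "- w"] by (simp add: K.neg f.neg)
  then show ?thesis by blast
qed

lemma riesz_representation:
  fixes f :: "'a::{real_inner, complete_space} \<Rightarrow> real"
  assumes "bounded_linear f"
  obtains u where "\<And>w. f w = u \<bullet> w"
proof -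
  obtain u where "\<forall>w. u \<bullet> w + 0 * ((0 :: 'a) \<bullet> 0) = f w"
    using energy_riesz[OF bounded_linear_zero assms, of 0] by auto
  then show ?thesis using that[of u] by simp
qed

lemma adjoint_hilbert:
  fixes K :: "'a::{real_inner, complete_space} \<Rightarrow> 'b::real_inner"
  assumes K: "bounded_linear K"
  shows inner_adjoint_hilbert: "K x \<bullet> y = x \<bullet> adjoint K y"
    and bounded_linear_adjoint: "bounded_linear (adjoint K)"
    and norm_adjoint_le: "norm (adjoint K y) \<le> onorm K * norm y"
proof -
  have "\<exists>z. \<forall>x. K x \<bullet> y = x \<bullet> z" for y
  proof -
    have "bounded_linear (\<lambda>x. K x \<bullet> y)" by (intro bounded_linear_intros K)
    then show ?thesis using riesz_representation[of "\<lambda>x. K x \<bullet> y"] by (metis inner_commute)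
  qed
  then obtain K' where "\<forall>x y. K x \<bullet> y = x \<bullet> K' y" by metis
  then have "\<forall>x y. K x \<bullet> y = x \<bullet> adjoint K y"
    unfolding adjoint_def by (rule someI[where P = "\<lambda>f'. \<forall>x y. K x \<bullet> y = x \<bullet> f' y"])
  then have adj: "K x \<bullet> y = x \<bullet> adjoint K y" for x y by blast
  show "K x \<bullet> y = x \<bullet> adjoint K y" by (rule adj)
  show le: "norm (adjoint K y) \<le> onorm K * norm y" for y
  proof -
    have "norm (adjoint K y) * norm (adjoint K y) = K (adjoint K y) \<bullet> y"
      unfolding adj by (metis power2_eq_square power2_norm_eq_inner)
    also have "\<dots> \<le> norm (K (adjoint K y)) * norm y" by (rule norm_cauchy_schwarz)
    also have "\<dots> \<le> onorm K * norm (adjoint K y) * norm y"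
      by (intro mult_right_mono onorm K) auto
    finally show ?thesis
      by (cases "norm (adjoint K y) = 0") (auto simp: onorm_pos_le[OF K] algebra_simps)
  qed
  show "bounded_linear (adjoint K)"
  proof (rule bounded_linear_intro[of _ "onorm K"])
    show "adjoint K (x + y) = adjoint K x + adjoint K y" for x y
      by (rule vector_eq_rdot[THEN iffD1]) (metis adj inner_add_right inner_commute)
    show "adjoint K (r *\<^sub>R x) = r *\<^sub>R adjoint K x" for r x
      by (rule vector_eq_rdot[THEN iffD1]) (metis adj inner_scaleR_right inner_commute)
    show "norm (adjoint K x) \<le> norm x * onorm K" for x using le by (simp add: mult.commute)
  qed
qed

text \<open>Sequential weak compactness of balls in a form that needs neither separability nor subsequences: by
Tychonoff's theorem the functionals \<open>(\<bullet>) (y k)\<close> have a cluster point \<open>g\<close> in a product of compact intervals,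
and refining the filter \<open>H\<close> by the neighbourhoods of \<open>g\<close> makes it a limit. The limit \<open>g\<close> is bounded and linear,
hence represented by a vector.\<close>

lemma bounded_weak_cluster_point:
  fixes y :: "'i \<Rightarrow> 'a::{real_inner, complete_space}"
  assumes H: "H \<noteq> bot" and bdd: "eventually (\<lambda>k. norm (y k) \<le> B) H"
  obtains H' y' where "H' \<le> H" "H' \<noteq> bot" "\<And>w. ((\<lambda>k. y k \<bullet> w) \<longlongrightarrow> y' \<bullet> w) H'"
proof -
  define \<Phi> where "\<Phi> k = (\<lambda>w. y k \<bullet> w)" for k
  let ?C = "PiE UNIV (\<lambda>w::'a. {- (B * norm w) .. B * norm w})"
  have "compactin (product_topology (\<lambda>w::'a. euclidean) UNIV) ?C"
    by (subst compactin_PiE) auto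
  then have C: "compact ?C" by (simp add: euclidean_product_topology)
  have in_C: "eventually (\<lambda>k. \<Phi> k \<in> ?C) H"
    using bdd
  proof eventually_elim
    case (elim k)
    have "\<bar>y k \<bullet> w\<bar> \<le> B * norm w" for w
      using Cauchy_Schwarz_ineq2[of "y k" w] elim by (meson mult_right_mono norm_ge_zero order_trans)
    then show ?case by (auto simp: \<Phi>_def abs_le_iff minus_le_iff)
  qed
  have "filtermap \<Phi> H \<noteq> bot" using H by (simp add: filtermap_bot_iff)
  moreover have "eventually (\<lambda>g. g \<in> ?C) (filtermap \<Phi> H)" using in_C by (simp add: eventually_filtermap)
  ultimately obtain g where g: "g \<in> ?C" "inf (nhds g) (filtermap \<Phi> H) \<noteq> bot"
    using C unfolding compact_filter by blast
  define H' where "H' = inf (filtercomap \<Phi> (nhds g)) H"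
  have "H' \<noteq> bot"
  proof
    assume "H' = bot"
    then have "eventually (\<lambda>_. False) H'" by simp
    then obtain P Q where PQ: "eventually P (filtercomap \<Phi> (nhds g))" "eventually Q H" "\<And>k. P k \<Longrightarrow> Q k \<Longrightarrow> False"
      unfolding H'_def eventually_inf by blast
    then obtain R where R: "eventually R (nhds g)" "\<And>k. R (\<Phi> k) \<Longrightarrow> P k" unfolding eventually_filtercomap by blast
    have "eventually (\<lambda>k. \<not> R (\<Phi> k)) H" using PQ(2) by (rule eventually_mono) (use PQ(3) R(2) in blast)
    then have "eventually (\<lambda>h. \<not> R h) (filtermap \<Phi> H)" by (simp add: eventually_filtermap)
    then have "eventually (\<lambda>_. False) (inf (nhds g) (filtermap \<Phi> H))"
      unfolding eventually_inf using R(1) by blast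
    then show False using g(2) by (simp add: trivial_limit_def)
  qed
  have "filterlim \<Phi> (nhds g) H'"
    unfolding H'_def filterlim_iff_le_filtercomap by simp
  then have lim: "((\<lambda>k. y k \<bullet> w) \<longlongrightarrow> g w) H'" for w
    using continuous_on_tendsto_compose[of UNIV "\<lambda>h. h w" \<Phi> g H'] by (auto simp: \<Phi>_def intro: continuous_on_product_coordinates)
  have "bounded_linear g"
  proof (rule bounded_linear_intro[of _ B])
    show "g (v + w) = g v + g w" for v w
    proof (rule tendsto_unique[OF \<open>H' \<noteq> bot\<close> lim])
      show "((\<lambda>k. y k \<bullet> (v + w)) \<longlongrightarrow> g v + g w) H'" unfolding inner_add_right by (intro tendsto_add lim)
    qed
    show "g (r *\<^sub>R v) = r *\<^sub>R g v" for r v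
    proof (rule tendsto_unique[OF \<open>H' \<noteq> bot\<close> lim])
      show "((\<lambda>k. y k \<bullet> (r *\<^sub>R v)) \<longlongrightarrow> r *\<^sub>R g v) H'" unfolding inner_scaleR_right by (auto intro!: tendsto_mult_left lim)
    qed
    show "norm (g v) \<le> norm v * B" for v
      using g(1) by (auto simp: PiE_iff abs_le_iff mult.commute minus_le_iff)
  qed
  then obtain y' where "\<And>w. g w = y' \<bullet> w" using riesz_representation by metis
  then show ?thesis using that[of H' y'] \<open>H' \<noteq> bot\<close> lim by (simp add: H'_def)
qed

text \<open>The two saddle-point inequalities are the subgradient inequalities of \<open>F\<close> at \<open>x'\<close> and of \<open>G\<close> at \<open>y'\<close> with
the coupling term moved to the other side.\<close>

lemma saddle_point_iff_subdiff:
  assumes adj: "\<And>x y. K x \<bullet> y = x \<bullet> Ks y" and prF: "proper_fun F" and prG: "proper_fun G"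
  shows "saddle_point K F G x' y' \<longleftrightarrow> - Ks y' \<in> subdiff F x' \<and> K x' \<in> subdiff G y'"
proof (cases "x' \<in> edom F \<and> y' \<in> edom G")
  case True
  then obtain r s where r: "F x' = ereal r" "G y' = ereal s"
    using real_on_edom[OF prF] real_on_edom[OF prG] by metis
  have "Lagr K F G x' y \<le> Lagr K F G x' y' \<longleftrightarrow> G y' + ereal (K x' \<bullet> (y - y')) \<le> G y" if "y \<in> edom G" for y
    using real_on_edom[OF prG that] r by (auto simp: Lagr_def inner_diff_right)
  moreover have "G y' + ereal (K x' \<bullet> (y - y')) \<le> G y" if "y \<notin> edom G" for y
    using that by (simp add: edom_def)
  moreover have "Lagr K F G x' y' \<le> Lagr K F G x y' \<longleftrightarrow> F x' + ereal ((- Ks y') \<bullet> (x - x')) \<le> F x" if "x \<in> edom F" for x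
    using real_on_edom[OF prF that] r by (auto simp: Lagr_def adj inner_diff_right inner_commute[of "Ks y'"])
  moreover have "F x' + ereal ((- Ks y') \<bullet> (x - x')) \<le> F x" if "x \<notin> edom F" for x
    using that by (simp add: edom_def)
  ultimately show ?thesis using True unfolding saddle_point_def subdiff_def by blast
qed (auto simp: saddle_point_def subdiff_def)

lemma tendsto_inner_weak_strong:
  fixes p :: "'i \<Rightarrow> 'a::real_inner"
  assumes p: "\<And>w. ((\<lambda>k. p k \<bullet> w) \<longlongrightarrow> p' \<bullet> w) H" and bdd: "eventually (\<lambda>k. norm (p k) \<le> B) H"
    and x: "(x \<longlongrightarrow> x') H"
  shows "((\<lambda>k. p k \<bullet> x k) \<longlongrightarrow> p' \<bullet> x') H"
proof -
  have "((\<lambda>k. p k \<bullet> (x k - x')) \<longlongrightarrow> 0) H"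
  proof (rule Lim_null_comparison)
    show "eventually (\<lambda>k. norm (p k \<bullet> (x k - x')) \<le> B * norm (x k - x')) H"
      using bdd
    proof eventually_elim
      case (elim k)
      then have "norm (p k) * norm (x k - x') \<le> B * norm (x k - x')" by (intro mult_right_mono) auto
      then show ?case using Cauchy_Schwarz_ineq2[of "p k" "x k - x'"] by simp
    qed
    show "((\<lambda>k. B * norm (x k - x')) \<longlongrightarrow> 0) H"
      using x by (intro tendsto_mult_right_zero tendsto_norm_zero) (simp add: LIM_zero)
  qed
  from tendsto_add[OF this p[of x']] show ?thesis by (simp add: inner_diff_right)
qed

section \<open>The accelerated scheme in preconditioned variables\<close>

text \<open>An inexact proximal point method for the operator \<open>(x, y) \<mapsto> (\<partial>F x + K\<^sup>* y, \<partial>G y - K x)\<close> with variable steps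
\<open>\<sigma>\<close>, \<open>\<tau>\<close>. Adding up, the points \<open>x = a\<^sub>k\<^sub>+\<^sub>1 - s K\<^sup>* v\<close> and \<open>y = c\<^sub>k\<^sub>+\<^sub>1 + s K u\<close> satisfy
\<open>(1 + s K\<^sup>* K) u \<in> \<partial>F x + K\<^sup>* y\<close> and \<open>(1 + s K K\<^sup>*) v \<in> \<partial>G y - K x\<close>. The
index \<open>k\<close> of \<open>u\<close> and \<open>v\<close> is that of the step from \<open>k\<close> to \<open>k + 1\<close>.\<close>

locale accelerated_proximal_scheme =
  fixes K :: "'a::{real_inner, complete_space} \<Rightarrow> 'b::{real_inner, complete_space}"
    and Ks :: "'b \<Rightarrow> 'a"
    and F :: "'a \<Rightarrow> ereal" and G :: "'b \<Rightarrow> ereal"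
    and \<gamma>1 \<gamma> s :: real and \<sigma> \<tau> :: "nat \<Rightarrow> real"
    and a u :: "nat \<Rightarrow> 'a" and c v :: "nat \<Rightarrow> 'b"
  assumes K: "bounded_linear K" and Ks: "bounded_linear Ks"
    and adj: "K x \<bullet> y = x \<bullet> Ks y" and Ks_le: "norm (Ks y) \<le> onorm K * norm y"
    and F: "proper_fun F" "convex_fun F" "lsc_fun F" "strongly_convex_fun \<gamma>1 F"
    and G: "proper_fun G" "convex_fun G" "lsc_fun G"
    and s_pos: "s > 0" and \<sigma>0_pos: "\<sigma> 0 > 0" and \<gamma>_pos: "\<gamma> > 0"
    and \<gamma>_less: "\<gamma> * (1 + s * (onorm K)\<^sup>2) < 2 * \<gamma>1"
    and \<sigma>_Suc: "\<sigma> (Suc k) = \<sigma> k / sqrt (1 + \<gamma> * \<sigma> k)" and \<tau>_\<sigma>: "\<tau> k * \<sigma> k = s"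
    and a_Suc: "a k = a (Suc k) + \<sigma> k *\<^sub>R u k"
    and c_Suc: "c k = c (Suc k) + \<tau> k *\<^sub>R v k"
    and subF: "u k - Ks (c (Suc k)) \<in> subdiff F (a (Suc k) - s *\<^sub>R Ks (v k))"
    and subG: "v k + K (a (Suc k)) \<in> subdiff G (c (Suc k) + s *\<^sub>R K (u k))"
begin

sublocale K: bounded_linear K by (rule K)
sublocale Ks: bounded_linear Ks by (rule Ks)

definition kkt :: "'a \<Rightarrow> 'b \<Rightarrow> bool" where
  "kkt x' y' \<longleftrightarrow> - Ks y' \<in> subdiff F x' \<and> K x' \<in> subdiff G y'"

text \<open>The squared norms induced by the preconditioners \<open>1 + s K\<^sup>* K\<close> and \<open>1 + s K K\<^sup>*\<close>.\<close>

definition hsq :: "'a \<Rightarrow> real" where "hsq w = (norm w)\<^sup>2 + s * (norm (K w))\<^sup>2"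
definition gsq :: "'b \<Rightarrow> real" where "gsq w = (norm w)\<^sup>2 + s * (norm (Ks w))\<^sup>2"

text \<open>The weight \<open>\<tau>\<^sub>k / \<sigma>\<^sub>k = s / \<sigma>\<^sub>k\<^sup>2\<close> grows like \<open>k\<^sup>2\<close>; this is where the rate comes from.\<close>

definition energy :: "'a \<Rightarrow> 'b \<Rightarrow> nat \<Rightarrow> real" where
  "energy x' y' k = \<tau> k / \<sigma> k * hsq (a k - x') + gsq (c k - y')"

lemma norm_sq_le_hsq: "(norm w)\<^sup>2 \<le> hsq w" and norm_sq_le_gsq: "(norm z)\<^sup>2 \<le> gsq z"
  using s_pos by (simp_all add: hsq_def gsq_def)

lemma hsq_nonneg: "0 \<le> hsq w" and gsq_nonneg: "0 \<le> gsq z"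
  using s_pos by (simp_all add: hsq_def gsq_def)

lemma \<sigma>_pos: "\<sigma> k > 0"
proof (induction k)
  case (Suc k)
  then have "1 + \<gamma> * \<sigma> k > 0" using \<gamma>_pos by (simp add: add_pos_pos)
  then show ?case using Suc by (simp add: \<sigma>_Suc)
qed (rule \<sigma>0_pos)

lemma \<tau>_eq: "\<tau> k = s / \<sigma> k"
  using \<tau>_\<sigma>[of k] \<sigma>_pos[of k] by (simp add: field_simps)

lemma \<tau>_pos: "\<tau> k > 0"
  using \<sigma>_pos s_pos by (simp add: \<tau>_eq)

lemma \<sigma>_decreasing: "\<sigma> (Suc k) \<le> \<sigma> k"
proof -
  have "1 \<le> sqrt (1 + \<gamma> * \<sigma> k)" using \<gamma>_pos \<sigma>_pos[of k] by simp
  then show ?thesis using \<sigma>_pos[of k] by (simp add: \<sigma>_Suc divide_le_eq)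
qed

text \<open>The increments of \<open>1 / \<sigma>\<close> are \<open>(sqrt (1 + \<gamma> \<sigma>\<^sub>k) - 1) / \<sigma>\<^sub>k = \<gamma> / (sqrt (1 + \<gamma> \<sigma>\<^sub>k) + 1)\<close>, which is bounded below
because \<open>\<sigma>\<close> decreases.\<close>

lemma \<sigma>_rate: "\<exists>D>0. \<forall>k. \<sigma> k \<le> D / real (Suc k)"
proof -
  define r where "r = sqrt (1 + \<gamma> * \<sigma> 0)"
  define e where "e = min (1 / \<sigma> 0) (\<gamma> / (r + 1))"
  have r: "r > 0" using \<gamma>_pos \<sigma>0_pos by (simp add: r_def add_pos_pos)
  then have e: "e > 0" using \<gamma>_pos \<sigma>0_pos by (simp add: e_def)
  have dec: "\<sigma> k \<le> \<sigma> 0" for k by (induction k) (use \<sigma>_decreasing order_trans in blast)+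
  have "e * real (Suc k) \<le> 1 / \<sigma> k" for k
  proof (induction k)
    case (Suc k)
    define q where "q = sqrt (1 + \<gamma> * \<sigma> k)"
    have q: "q > 0" "q\<^sup>2 = 1 + \<gamma> * \<sigma> k" "q \<le> r"
      using \<gamma>_pos \<sigma>_pos[of k] dec[of k] by (auto simp: q_def r_def add_pos_pos)
    have "(q - 1) * (q + 1) = \<gamma> * \<sigma> k" using q(2) by (simp add: algebra_simps power2_eq_square)
    then have "(q - 1) / \<sigma> k = \<gamma> / (q + 1)" using q(1) \<sigma>_pos[of k] by (simp add: field_simps)
    then have "1 / \<sigma> (Suc k) = 1 / \<sigma> k + \<gamma> / (q + 1)"
      using \<sigma>_pos[of k] q(1) by (simp add: \<sigma>_Suc diff_divide_distrib flip: q_def)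
    moreover have "\<gamma> / (q + 1) \<ge> \<gamma> / (r + 1)" using q \<gamma>_pos by (intro divide_left_mono) auto
    ultimately show ?case using Suc.IH by (simp add: e_def algebra_simps)
  qed (simp add: e_def)
  then have "e * real (Suc k) * \<sigma> k \<le> 1" for k
    using \<sigma>_pos[of k] by (simp add: le_divide_eq del: of_nat_Suc)
  then have "\<sigma> k \<le> (1 / e) / real (Suc k)" for k
    using e by (simp add: le_divide_eq mult.commute mult.left_commute del: of_nat_Suc)
  then show ?thesis using e by (intro exI[of _ "1 / e"]) auto
qed

lemma \<sigma>_tendsto_0: "\<sigma> \<longlonglongrightarrow> 0"
proof -
  obtain D where D: "\<And>k. \<sigma> k \<le> D / real (Suc k)" using \<sigma>_rate by blast
  have "(\<lambda>k. D / real (Suc k)) \<longlonglongrightarrow> 0"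
    by (rule LIMSEQ_Suc[OF lim_const_over_n])
  then show ?thesis
    by (rule Lim_null_comparison[rotated])
       (use D \<sigma>_pos in \<open>auto intro!: always_eventually simp: abs_of_pos simp del: of_nat_Suc\<close>)
qed

lemma \<tau>_eventually_ge: "eventually (\<lambda>k. T \<le> \<tau> k) sequentially"
proof -
  have "eventually (\<lambda>k. \<sigma> k < s / (\<bar>T\<bar> + 1)) sequentially"
    using \<sigma>_tendsto_0 s_pos by (intro order_tendstoD) auto
  then show ?thesis
  proof eventually_elim
    case (elim k)
    then have "\<bar>T\<bar> + 1 < \<tau> k" using \<sigma>_pos[of k] by (simp add: \<tau>_eq field_simps)
    then show ?case by linarith
  qed
qed

text \<open>The point of the preconditioned variables: pairing subgradients with the shifted arguments leaves exactly
the inner products that belong to \<^const>\<open>hsq\<close> and \<^const>\<open>gsq\<close>, because the skew coupling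
and all other cross terms cancel.\<close>

lemma primal_dual_pairing:
  "(u' - Ks c') \<bullet> (a' - s *\<^sub>R Ks v') + (v' + K a') \<bullet> (c' + s *\<^sub>R K u')
    = u' \<bullet> a' + s * (K u' \<bullet> K a') + (v' \<bullet> c' + s * (Ks v' \<bullet> Ks c'))"
  by (simp add: inner_diff_left inner_diff_right inner_add_left inner_add_right inner_commute adj
      flip: adj) (simp add: adj inner_commute algebra_simps)

text \<open>Expand the squares of \<open>a\<^sub>k - x' = (a\<^sub>k\<^sub>+\<^sub>1 - x') + \<sigma>\<^sub>k u\<close> and \<open>c\<^sub>k - y' = (c\<^sub>k\<^sub>+\<^sub>1 - y') + \<tau>\<^sub>k v\<close>; the mixed terms are
those of \<open>primal_dual_pairing\<close>. The negative term stems from the growth of the weight,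
\<open>\<tau>\<^sub>k\<^sub>+\<^sub>1 / \<sigma>\<^sub>k\<^sub>+\<^sub>1 = \<tau>\<^sub>k / \<sigma>\<^sub>k + \<gamma> \<tau>\<^sub>k\<close>.\<close>

lemma energy_identity:
  "energy x' y' k = energy x' y' (Suc k)
    + \<tau> k * (2 * ((u k - Ks (c (Suc k) - y')) \<bullet> ((a (Suc k) - x') - s *\<^sub>R Ks (v k))
              + (v k + K (a (Suc k) - x')) \<bullet> ((c (Suc k) - y') + s *\<^sub>R K (u k)))
        + \<sigma> k * hsq (u k) + \<tau> k * gsq (v k) - \<gamma> * hsq (a (Suc k) - x'))"
proof -
  define A where "A = a (Suc k) - x'"
  define C where "C = c (Suc k) - y'"
  have A: "a k - x' = A + \<sigma> k *\<^sub>R u k" and C: "c k - y' = C + \<tau> k *\<^sub>R v k"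
    by (simp_all add: a_Suc[of k] c_Suc[of k] A_def C_def)
  have h: "hsq (A + \<sigma> k *\<^sub>R u k) = hsq A + 2 * \<sigma> k * (u k \<bullet> A + s * (K (u k) \<bullet> K A)) + (\<sigma> k)\<^sup>2 * hsq (u k)"
    unfolding hsq_def K.add K.scaleR power2_norm_eq_inner
    by (simp add: inner_add_left inner_add_right inner_commute power2_eq_square algebra_simps)
  have g: "gsq (C + \<tau> k *\<^sub>R v k) = gsq C + 2 * \<tau> k * (v k \<bullet> C + s * (Ks (v k) \<bullet> Ks C)) + (\<tau> k)\<^sup>2 * gsq (v k)"
    unfolding gsq_def Ks.add Ks.scaleR power2_norm_eq_inner
    by (simp add: inner_add_left inner_add_right inner_commute power2_eq_square algebra_simps)
  have \<sigma>: "\<sigma> k > 0" "1 + \<gamma> * \<sigma> k > 0" using \<sigma>_pos[of k] \<gamma>_pos by (auto simp: add_pos_pos)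
  have "(\<sigma> (Suc k))\<^sup>2 = (\<sigma> k)\<^sup>2 / (1 + \<gamma> * \<sigma> k)"
    using \<sigma> by (simp add: \<sigma>_Suc power_divide)
  then have "\<tau> (Suc k) / \<sigma> (Suc k) = s / ((\<sigma> k)\<^sup>2 / (1 + \<gamma> * \<sigma> k))"
    by (simp add: \<tau>_eq power2_eq_square)
  also have "\<dots> = \<tau> k / \<sigma> k + \<gamma> * \<tau> k" using \<sigma> by (simp add: \<tau>_eq field_simps power2_eq_square)
  finally have r: "\<tau> (Suc k) / \<sigma> (Suc k) = \<tau> k / \<sigma> k + \<gamma> * \<tau> k" .
  have "energy x' y' k = \<tau> k / \<sigma> k * hsq A + gsq C
      + (\<tau> k / \<sigma> k * \<sigma> k) * (2 * (u k \<bullet> A + s * (K (u k) \<bullet> K A)) + \<sigma> k * hsq (u k))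
      + \<tau> k * (2 * (v k \<bullet> C + s * (Ks (v k) \<bullet> Ks C)) + \<tau> k * gsq (v k))"
    unfolding energy_def A C h g by (simp add: algebra_simps power2_eq_square)
  also have "\<tau> k / \<sigma> k * \<sigma> k = \<tau> k" using \<sigma> by simp
  finally show ?thesis
    unfolding energy_def r A_def[symmetric] C_def[symmetric] primal_dual_pairing
    by (simp add: algebra_simps)
qed

text \<open>Strong monotonicity controls \<open>x\<^sub>k\<^sub>+\<^sub>1 - x'\<close>, but the energy contains \<open>a\<^sub>k\<^sub>+\<^sub>1 - x' = (x\<^sub>k\<^sub>+\<^sub>1 - x') + s K\<^sup>* v\<close>. The strict
inequality between \<open>\<gamma> (1 + s \<parallel>K\<parallel>\<^sup>2)\<close> and \<open>2 \<gamma>\<^sub>1\<close> makes it possible to separate the two summands by Young's inequality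
without losing the constant \<open>2 \<gamma>\<^sub>1\<close>, at the cost of a possibly large multiple of \<open>\<parallel>v\<parallel>\<^sup>2\<close>.\<close>

lemma \<gamma>_hsq_le:
  obtains B where "B \<ge> 0" "\<And>x w. \<gamma> * hsq (x + s *\<^sub>R Ks w) \<le> 2 * \<gamma>1 * (norm x)\<^sup>2 + B * (norm w)\<^sup>2"
proof -
  define M where "M = 1 + s * (onorm K)\<^sup>2"
  have M: "M \<ge> 1" using s_pos by (simp add: M_def)
  \<comment> \<open>Young's parameter, chosen to use up the gap in the bound on \<open>\<gamma>\<close>\<close>
  define e where "e = 2 * \<gamma>1 / (\<gamma> * M) - 1"
  have "1 < 2 * \<gamma>1 / (\<gamma> * M)" using \<gamma>_less \<gamma>_pos M by (simp add: less_divide_eq M_def)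
  then have e: "e > 0" by (simp add: e_def)
  have e\<gamma>: "\<gamma> * M * (1 + e) = 2 * \<gamma>1" using \<gamma>_pos M by (simp add: e_def)
  define B where "B = \<gamma> * M * ((1 + 1 / e) * (s * onorm K)\<^sup>2)"
  show ?thesis
  proof (rule that[of B])
    show "B \<ge> 0" using \<gamma>_pos M e by (simp add: B_def)
    fix x w
    let ?z = "s *\<^sub>R Ks w"
    have "(norm (K (x + ?z)))\<^sup>2 \<le> (onorm K * norm (x + ?z))\<^sup>2"
      by (intro power_mono onorm K) auto
    then have "s * (norm (K (x + ?z)))\<^sup>2 \<le> s * (onorm K * norm (x + ?z))\<^sup>2" using s_pos by simp
    then have 1: "hsq (x + ?z) \<le> M * (norm (x + ?z))\<^sup>2"
      by (simp add: hsq_def M_def algebra_simps power_mult_distrib)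
    have "norm (x + ?z) \<le> norm x + s * onorm K * norm w"
    proof -
      have "norm ?z \<le> s * (onorm K * norm w)" using Ks_le[of w] s_pos by simp
      then show ?thesis using norm_triangle_ineq[of x ?z] by (simp add: mult.assoc)
    qed
    then have "(norm (x + ?z))\<^sup>2 \<le> (norm x + s * onorm K * norm w)\<^sup>2" by (intro power_mono) auto
    also have "\<dots> \<le> (1 + e) * (norm x)\<^sup>2 + (1 + 1 / e) * (s * onorm K * norm w)\<^sup>2"
    proof -
      have "0 \<le> (e * norm x - s * onorm K * norm w)\<^sup>2 / e" using e by simp
      also have "\<dots> = (1 + e) * (norm x)\<^sup>2 + (1 + 1 / e) * (s * onorm K * norm w)\<^sup>2 - (norm x + s * onorm K * norm w)\<^sup>2"
        using e by (simp add: field_simps power2_eq_square)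
      finally show ?thesis by simp
    qed
    finally have 2: "(norm (x + ?z))\<^sup>2 \<le> (1 + e) * (norm x)\<^sup>2 + (1 + 1 / e) * (s * onorm K * norm w)\<^sup>2" .
    have "\<gamma> * hsq (x + ?z) \<le> \<gamma> * (M * ((1 + e) * (norm x)\<^sup>2 + (1 + 1 / e) * (s * onorm K * norm w)\<^sup>2))"
    proof (intro mult_left_mono)
      show "hsq (x + ?z) \<le> M * ((1 + e) * (norm x)\<^sup>2 + (1 + 1 / e) * (s * onorm K * norm w)\<^sup>2)"
        using 1 2 M by (meson mult_left_mono order_trans zero_le_one)
    qed (use \<gamma>_pos in simp)
    also have "\<dots> = (\<gamma> * M * (1 + e)) * (norm x)\<^sup>2 + B * (norm w)\<^sup>2"
      by (simp add: B_def algebra_simps power_mult_distrib)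
    finally show "\<gamma> * hsq (x + ?z) \<le> 2 * \<gamma>1 * (norm x)\<^sup>2 + B * (norm w)\<^sup>2" unfolding e\<gamma> .
  qed
qed

text \<open>The term \<open>B \<parallel>v\<parallel>\<^sup>2\<close> of the preceding estimate is absorbed by half of \<open>\<tau>\<^sub>k \<parallel>v\<parallel>\<^sup>2\<close>. This is possible only
for \<open>\<tau>\<^sub>k \<ge> 2 B\<close>, hence the descent starts at some index that depends on the data.\<close>

lemma energy_descent:
  assumes "kkt x' y'"
  shows "eventually (\<lambda>k. energy x' y' (Suc k) + s * (norm (u k))\<^sup>2 + (\<tau> k)\<^sup>2 / 2 * (norm (v k))\<^sup>2
            \<le> energy x' y' k) sequentially"
proof -
  obtain B where B: "B \<ge> 0" "\<And>x w. \<gamma> * hsq (x + s *\<^sub>R Ks w) \<le> 2 * \<gamma>1 * (norm x)\<^sup>2 + B * (norm w)\<^sup>2"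
    using \<gamma>_hsq_le by blast
  show ?thesis
    using \<tau>_eventually_ge[of "2 * B"]
  proof eventually_elim
    case (elim k)
    let ?X = "(a (Suc k) - x') - s *\<^sub>R Ks (v k)" and ?Y = "(c (Suc k) - y') + s *\<^sub>R K (u k)"
    let ?P = "u k - Ks (c (Suc k) - y')" and ?Q = "v k + K (a (Suc k) - x')"
    have k: "- Ks y' \<in> subdiff F x'" "K x' \<in> subdiff G y'" using assms by (auto simp: kkt_def)
    have "\<gamma>1 * (norm ((a (Suc k) - s *\<^sub>R Ks (v k)) - x'))\<^sup>2
        \<le> ((u k - Ks (c (Suc k))) - (- Ks y')) \<bullet> ((a (Suc k) - s *\<^sub>R Ks (v k)) - x')"
      by (rule subdiff_strongly_monotone[OF F(1) F(4) subF k(1)])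
    then have 1: "\<gamma>1 * (norm ?X)\<^sup>2 \<le> ?P \<bullet> ?X" by (simp add: Ks.diff algebra_simps)
    have "0 \<le> ((v k + K (a (Suc k))) - K x') \<bullet> ((c (Suc k) + s *\<^sub>R K (u k)) - y')"
      by (rule subdiff_monotone[OF G(1) subG k(2)])
    then have 2: "0 \<le> ?Q \<bullet> ?Y" by (simp add: K.diff algebra_simps)
    have 3: "\<gamma> * hsq (a (Suc k) - x') \<le> 2 * \<gamma>1 * (norm ?X)\<^sup>2 + B * (norm (v k))\<^sup>2"
      using B(2)[of ?X "v k"] by simp
    have "B * (norm (v k))\<^sup>2 \<le> \<tau> k / 2 * (norm (v k))\<^sup>2" using elim by (intro mult_right_mono) auto
    moreover have "\<tau> k * (norm (v k))\<^sup>2 \<le> \<tau> k * gsq (v k)" "\<sigma> k * (norm (u k))\<^sup>2 \<le> \<sigma> k * hsq (u k)"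
      using \<tau>_pos \<sigma>_pos norm_sq_le_gsq norm_sq_le_hsq by (auto intro!: mult_left_mono simp: less_imp_le)
    ultimately have "\<sigma> k * (norm (u k))\<^sup>2 + \<tau> k / 2 * (norm (v k))\<^sup>2
        \<le> 2 * (?P \<bullet> ?X + ?Q \<bullet> ?Y) + \<sigma> k * hsq (u k) + \<tau> k * gsq (v k) - \<gamma> * hsq (a (Suc k) - x')"
      using 1 2 3 by argo
    then have "\<tau> k * (\<sigma> k * (norm (u k))\<^sup>2 + \<tau> k / 2 * (norm (v k))\<^sup>2)
        \<le> energy x' y' k - energy x' y' (Suc k)"
      unfolding energy_identity[of x' y' k] using \<tau>_pos[of k] by (simp add: mult_left_mono less_imp_le)
    moreover have "\<tau> k * (\<sigma> k * (norm (u k))\<^sup>2 + \<tau> k / 2 * (norm (v k))\<^sup>2)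
        = (\<tau> k * \<sigma> k) * (norm (u k))\<^sup>2 + (\<tau> k)\<^sup>2 / 2 * (norm (v k))\<^sup>2"
      by (simp add: algebra_simps power2_eq_square)
    ultimately show ?case unfolding \<tau>_\<sigma> by linarith
  qed
qed

lemma energy_nonneg: "0 \<le> energy x' y' k"
  using \<tau>_pos[of k] \<sigma>_pos[of k] hsq_nonneg gsq_nonneg by (simp add: energy_def)

lemma energy_convergent:
  assumes "kkt x' y'"
  shows "convergent (energy x' y')"
proof -
  obtain N where N: "\<And>k. k \<ge> N \<Longrightarrow> energy x' y' (Suc k) + s * (norm (u k))\<^sup>2 + (\<tau> k)\<^sup>2 / 2 * (norm (v k))\<^sup>2
      \<le> energy x' y' k"
    using energy_descent[OF assms] unfolding eventually_sequentially by blast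
  have "energy x' y' (Suc k) \<le> energy x' y' k" if "k \<ge> N" for k
  proof -
    have "0 \<le> s * (norm (u k))\<^sup>2" "0 \<le> (\<tau> k)\<^sup>2 / 2 * (norm (v k))\<^sup>2" using s_pos by auto
    then show ?thesis using N[OF that] by linarith
  qed
  then have "decseq (\<lambda>k. energy x' y' (k + N))" by (intro decseq_SucI) simp
  then obtain l where "(\<lambda>k. energy x' y' (k + N)) \<longlonglongrightarrow> l"
    using decseq_convergent[of _ 0] energy_nonneg by metis
  then show ?thesis unfolding convergent_def by (metis LIMSEQ_offset)
qed

lemma energy_bounded:
  assumes "kkt x' y'"
  obtains B where "B \<ge> 0" "\<And>k. energy x' y' k \<le> B"
proof -
  obtain B where B: "\<And>k. norm (energy x' y' k) \<le> B"
    using convergent_imp_Bseq[OF energy_convergent[OF assms]] by (auto simp: Bseq_def)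
  show ?thesis
  proof (rule that[of B])
    show "B \<ge> 0" using B[of 0] norm_ge_zero by (rule order_trans[rotated])
    show "energy x' y' k \<le> B" for k using B[of k] by simp
  qed
qed

lemma u_tendsto_0:
  assumes "kkt x' y'"
  shows "u \<longlonglongrightarrow> 0"
proof -
  obtain l where l: "energy x' y' \<longlonglongrightarrow> l"
    using energy_convergent[OF assms] by (auto simp: convergent_def)
  have "(\<lambda>k. (energy x' y' k - energy x' y' (Suc k)) / s) \<longlonglongrightarrow> (l - l) / s"
    using s_pos by (intro tendsto_intros l LIMSEQ_Suc) auto
  then have "(\<lambda>k. (energy x' y' k - energy x' y' (Suc k)) / s) \<longlonglongrightarrow> 0" by simp
  then have "(\<lambda>k. (norm (u k))\<^sup>2) \<longlonglongrightarrow> 0"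
  proof (rule Lim_null_comparison[rotated])
    show "eventually (\<lambda>k. norm ((norm (u k))\<^sup>2) \<le> (energy x' y' k - energy x' y' (Suc k)) / s) sequentially"
      using energy_descent[OF assms]
    proof eventually_elim
      case (elim k)
      have "0 \<le> (\<tau> k)\<^sup>2 / 2 * (norm (v k))\<^sup>2" by simp
      then have "s * (norm (u k))\<^sup>2 \<le> energy x' y' k - energy x' y' (Suc k)" using elim by linarith
      then show ?case using s_pos by (simp add: le_divide_eq mult.commute)
    qed
  qed
  then have "(\<lambda>k. sqrt ((norm (u k))\<^sup>2)) \<longlonglongrightarrow> sqrt 0" by (intro tendsto_intros)
  then show ?thesis by (simp add: tendsto_norm_zero_iff)
qed

lemma a_rate:
  assumes B: "energy x' y' k \<le> B"
  shows "(norm (a k - x'))\<^sup>2 \<le> B / s * (\<sigma> k)\<^sup>2"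
proof -
  have "s / (\<sigma> k)\<^sup>2 * (norm (a k - x'))\<^sup>2 \<le> s / (\<sigma> k)\<^sup>2 * hsq (a k - x')"
    using s_pos norm_sq_le_hsq by (intro mult_left_mono) auto
  also have "\<dots> \<le> energy x' y' k"
    using gsq_nonneg[of "c k - y'"] by (simp add: energy_def \<tau>_eq power2_eq_square)
  finally have "s / (\<sigma> k)\<^sup>2 * (norm (a k - x'))\<^sup>2 \<le> B" using B by linarith
  then show ?thesis using s_pos \<sigma>_pos[of k] by (simp add: field_simps)
qed

lemma v_rate:
  assumes "kkt x' y'" and B: "\<And>k. energy x' y' k \<le> B"
  shows "eventually (\<lambda>k. (norm (v k))\<^sup>2 \<le> 2 * B / s\<^sup>2 * (\<sigma> k)\<^sup>2) sequentially"
  using energy_descent[OF assms(1)]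
proof eventually_elim
  case (elim k)
  have "0 \<le> s * (norm (u k))\<^sup>2" using s_pos by simp
  then have "(\<tau> k)\<^sup>2 / 2 * (norm (v k))\<^sup>2 \<le> B"
    using elim B[of k] energy_nonneg[of x' y' "Suc k"] by linarith
  then show ?case using s_pos \<sigma>_pos[of k] by (simp add: \<tau>_eq field_simps)
qed

text \<open>Both \<open>a\<^sub>k\<^sub>+\<^sub>1 - x'\<close> and the correction \<open>s K\<^sup>* v\<close> are of order \<open>\<sigma>\<^sub>k\<close>: the first by the weight in the energy, the
second because the descent of the energy bounds \<open>\<tau>\<^sub>k\<^sup>2 \<parallel>v\<parallel>\<^sup>2\<close>.\<close>

lemma primal_rate:
  assumes "kkt x' y'"
  shows "\<exists>C. eventually (\<lambda>k. (norm (a (Suc k) - s *\<^sub>R Ks (v k) - x'))\<^sup>2 \<le> C / (real (Suc k))\<^sup>2) sequentially"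
proof -
  obtain B where B: "B \<ge> 0" "\<And>k. energy x' y' k \<le> B" using energy_bounded[OF assms] by blast
  obtain D where D: "D > 0" "\<And>k. \<sigma> k \<le> D / real (Suc k)" using \<sigma>_rate by blast
  define C where "C = 2 * (B / s) + 2 * ((s * onorm K)\<^sup>2 * (2 * B / s\<^sup>2))"
  have C: "C \<ge> 0" using B s_pos by (simp add: C_def)
  have "eventually (\<lambda>k. (norm (a (Suc k) - s *\<^sub>R Ks (v k) - x'))\<^sup>2 \<le> C * D\<^sup>2 / (real (Suc k))\<^sup>2) sequentially"
    using v_rate[OF assms B(2)]
  proof eventually_elim
    case (elim k)
    have "(norm (s *\<^sub>R Ks (v k)))\<^sup>2 \<le> (s * (onorm K * norm (v k)))\<^sup>2"
      using s_pos Ks_le by (intro power_mono) auto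
    also have "\<dots> = (s * onorm K)\<^sup>2 * (norm (v k))\<^sup>2" by (simp add: power_mult_distrib)
    also have "\<dots> \<le> (s * onorm K)\<^sup>2 * (2 * B / s\<^sup>2 * (\<sigma> k)\<^sup>2)" using elim by (intro mult_left_mono) auto
    finally have 1: "(norm (s *\<^sub>R Ks (v k)))\<^sup>2 \<le> (s * onorm K)\<^sup>2 * (2 * B / s\<^sup>2 * (\<sigma> k)\<^sup>2)" .
    have "(norm (a (Suc k) - x'))\<^sup>2 \<le> B / s * (\<sigma> (Suc k))\<^sup>2" by (rule a_rate[OF B(2)])
    also have "\<dots> \<le> B / s * (\<sigma> k)\<^sup>2"
      using \<sigma>_decreasing[of k] \<sigma>_pos[of "Suc k"] B s_pos by (intro mult_left_mono power_mono) auto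
    finally have 2: "(norm (a (Suc k) - x'))\<^sup>2 \<le> B / s * (\<sigma> k)\<^sup>2" .
    have "(norm (a (Suc k) - s *\<^sub>R Ks (v k) - x'))\<^sup>2 = (norm ((a (Suc k) - x') - s *\<^sub>R Ks (v k)))\<^sup>2"
      by (simp add: algebra_simps)
    also have "\<dots> \<le> (norm (a (Suc k) - x') + norm (s *\<^sub>R Ks (v k)))\<^sup>2"
      by (intro power_mono norm_triangle_ineq4) auto
    also have "\<dots> \<le> 2 * (norm (a (Suc k) - x'))\<^sup>2 + 2 * (norm (s *\<^sub>R Ks (v k)))\<^sup>2"
      using sum_squares_bound[of "norm (a (Suc k) - x')" "norm (s *\<^sub>R Ks (v k))"]
      by (simp add: power2_eq_square algebra_simps)
    also have "\<dots> \<le> 2 * (B / s * (\<sigma> k)\<^sup>2) + 2 * ((s * onorm K)\<^sup>2 * (2 * B / s\<^sup>2 * (\<sigma> k)\<^sup>2))"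
      using 1 2 by linarith
    also have "\<dots> = C * (\<sigma> k)\<^sup>2" by (simp add: C_def distrib_right)
    also have "\<dots> \<le> C * (D / real (Suc k))\<^sup>2"
      using D(2)[of k] \<sigma>_pos[of k] C by (intro mult_left_mono power_mono) auto
    finally show ?case by (simp add: power_divide)
  qed
  then show ?thesis by blast
qed

lemma v_tendsto_0:
  assumes "kkt x' y'"
  shows "v \<longlonglongrightarrow> 0"
proof -
  obtain B where B: "B \<ge> 0" "\<And>k. energy x' y' k \<le> B" using energy_bounded[OF assms] by blast
  have "(\<lambda>k. 2 * B / s\<^sup>2 * (\<sigma> k)\<^sup>2) \<longlonglongrightarrow> 2 * B / s\<^sup>2 * 0\<^sup>2" by (intro tendsto_intros \<sigma>_tendsto_0)
  then have "(\<lambda>k. 2 * B / s\<^sup>2 * (\<sigma> k)\<^sup>2) \<longlonglongrightarrow> 0" by simp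
  then have "(\<lambda>k. (norm (v k))\<^sup>2) \<longlonglongrightarrow> 0"
    by (rule Lim_null_comparison[rotated]) (use v_rate[OF assms B(2)] in simp)
  then have "(\<lambda>k. sqrt ((norm (v k))\<^sup>2)) \<longlonglongrightarrow> sqrt 0" by (intro tendsto_intros)
  then show ?thesis by (simp add: tendsto_norm_zero_iff)
qed

lemma a_tendsto:
  assumes "kkt x' y'"
  shows "a \<longlonglongrightarrow> x'"
proof -
  obtain B where B: "B \<ge> 0" "\<And>k. energy x' y' k \<le> B" using energy_bounded[OF assms] by blast
  have "(\<lambda>k. B / s * (\<sigma> k)\<^sup>2) \<longlonglongrightarrow> B / s * 0\<^sup>2" by (intro tendsto_intros \<sigma>_tendsto_0)
  then have "(\<lambda>k. B / s * (\<sigma> k)\<^sup>2) \<longlonglongrightarrow> 0" by simp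
  then have "(\<lambda>k. (norm (a k - x'))\<^sup>2) \<longlonglongrightarrow> 0"
    by (rule Lim_null_comparison[rotated]) (use a_rate[OF B(2)] in simp)
  then have "(\<lambda>k. sqrt ((norm (a k - x'))\<^sup>2)) \<longlonglongrightarrow> sqrt 0" by (intro tendsto_intros)
  then show ?thesis by (simp add: tendsto_norm_zero_iff LIM_zero_iff)
qed

lemma primal_tendsto:
  assumes "kkt x' y'"
  shows "(\<lambda>k. a (Suc k) - s *\<^sub>R Ks (v k)) \<longlonglongrightarrow> x'"
proof -
  have "(\<lambda>k. a (Suc k) - s *\<^sub>R Ks (v k)) \<longlonglongrightarrow> x' - s *\<^sub>R Ks 0"
    by (intro tendsto_intros LIMSEQ_Suc a_tendsto[OF assms] Ks.tendsto v_tendsto_0[OF assms])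
  then show ?thesis by simp
qed

lemma c_bounded:
  assumes "kkt x' y'"
  obtains B where "\<And>k. norm (c k) \<le> B"
proof -
  obtain B where B: "B \<ge> 0" "\<And>k. energy x' y' k \<le> B" using energy_bounded[OF assms] by blast
  have "norm (c k) \<le> sqrt B + norm y'" for k
  proof -
    have "(norm (c k - y'))\<^sup>2 \<le> energy x' y' k"
      using norm_sq_le_gsq[of "c k - y'"] hsq_nonneg[of "a k - x'"] \<tau>_pos[of k] \<sigma>_pos[of k]
      by (simp add: energy_def add_increasing)
    then have "norm (c k - y') \<le> sqrt B" using B(2)[of k] by (intro real_le_rsqrt) simp
    then show ?thesis using norm_triangle_ineq[of "c k - y'" y'] by simp
  qed
  then show ?thesis by (rule that)
qed

text \<open>Along \<open>H\<close> the primal arguments converge strongly to \<open>x'\<close> and the primal subgradients \<open>u - K\<^sup>* c\<close> weakly to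
\<open>- K\<^sup>* y'\<close>; the dual arguments converge weakly to \<open>y'\<close> and the dual subgradients strongly to \<open>K x'\<close>. Both
pairings pass to the limit.\<close>

lemma weak_cluster_point_kkt:
  assumes kkt: "kkt x' y0" and H: "H \<noteq> bot" "H \<le> sequentially"
    and lim: "\<And>w. ((\<lambda>k. c (Suc k) \<bullet> w) \<longlongrightarrow> y' \<bullet> w) H"
  shows "kkt x' y'"
proof -
  obtain B where B: "\<And>k. norm (c k) \<le> B" using c_bounded[OF kkt] by blast
  have u: "(u \<longlongrightarrow> 0) H" and v: "(v \<longlongrightarrow> 0) H" and a: "((\<lambda>k. a (Suc k)) \<longlongrightarrow> x') H"
    and X: "((\<lambda>k. a (Suc k) - s *\<^sub>R Ks (v k)) \<longlongrightarrow> x') H"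
    using u_tendsto_0[OF kkt] v_tendsto_0[OF kkt] LIMSEQ_Suc[OF a_tendsto[OF kkt]] primal_tendsto[OF kkt]
    by (auto intro: tendsto_mono[OF H(2)])
  have u1: "eventually (\<lambda>k. norm (u k) < 1) H"
    using tendsto_norm[OF u] by (intro order_tendstoD) auto
  have Y: "((\<lambda>k. (c (Suc k) + s *\<^sub>R K (u k)) \<bullet> w) \<longlongrightarrow> y' \<bullet> w) H" for w
  proof -
    have "((\<lambda>k. c (Suc k) \<bullet> w + s * (K (u k) \<bullet> w)) \<longlongrightarrow> y' \<bullet> w + s * (K 0 \<bullet> w)) H"
      by (intro tendsto_intros lim K.tendsto u)
    then show ?thesis by (simp add: inner_add_left)
  qed
  have Q: "((\<lambda>k. v k + K (a (Suc k))) \<longlongrightarrow> K x') H"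
    using tendsto_add[OF v K.tendsto[OF a]] by simp
  have P: "((\<lambda>k. (u k - Ks (c (Suc k))) \<bullet> w) \<longlongrightarrow> - Ks y' \<bullet> w) H" for w
  proof -
    have "((\<lambda>k. u k \<bullet> w - c (Suc k) \<bullet> K w) \<longlongrightarrow> 0 \<bullet> w - y' \<bullet> K w) H"
      by (intro tendsto_intros lim u)
    then show ?thesis by (simp add: inner_diff_left inner_commute[of _ "K w"] adj inner_commute[of w])
  qed
  have Pb: "eventually (\<lambda>k. norm (u k - Ks (c (Suc k))) \<le> 1 + onorm K * B) H"
    using u1
  proof eventually_elim
    case (elim k)
    have "norm (Ks (c (Suc k))) \<le> onorm K * B"
      using Ks_le[of "c (Suc k)"] B[of "Suc k"] onorm_pos_le[OF K] by (meson mult_left_mono order_trans)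
    then show ?case using elim norm_triangle_ineq4[of "u k" "Ks (c (Suc k))"] by linarith
  qed
  have Yb: "eventually (\<lambda>k. norm (c (Suc k) + s *\<^sub>R K (u k)) \<le> B + s * onorm K) H"
    using u1
  proof eventually_elim
    case (elim k)
    have "norm (K (u k)) \<le> onorm K * 1"
      using onorm[OF K, of "u k"] elim onorm_pos_le[OF K] by (meson less_imp_le mult_left_mono order_trans)
    then have "norm (s *\<^sub>R K (u k)) \<le> s * onorm K" using s_pos by simp
    then show ?case using B[of "Suc k"] norm_triangle_ineq[of "c (Suc k)" "s *\<^sub>R K (u k)"] by linarith
  qed
  have "- Ks y' \<in> subdiff F x'"
    by (rule subdiff_demiclosed[OF F(1-3) H(1) _ _ P tendsto_inner_weak_strong[OF P Pb X]])
       (auto intro: always_eventually subF tendsto_inner X)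
  moreover have "K x' \<in> subdiff G y'"
  proof (rule subdiff_demiclosed[OF G H(1) _ Y])
    show "((\<lambda>k. (v k + K (a (Suc k))) \<bullet> (c (Suc k) + s *\<^sub>R K (u k))) \<longlongrightarrow> K x' \<bullet> y') H"
      using tendsto_inner_weak_strong[OF Y Yb Q] by (simp add: inner_commute)
  qed (auto intro: always_eventually subG tendsto_inner Q)
  ultimately show ?thesis by (simp add: kkt_def)
qed

text \<open>Opial's argument. The two energies share the unbounded weight together with the primal distance, so
their difference is affine in \<open>c\<^sub>k\<close>, with gradient a multiple of
\<open>z = (1 + s K K\<^sup>*) (y1 - y2)\<close>. Hence \<open>c\<^sub>k \<bullet> z\<close> converges, \<open>(y1 - y2) \<bullet> z = 0\<close>, and \<open>1 + s K K\<^sup>*\<close> is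
positive definite.\<close>

lemma weak_cluster_point_unique:
  assumes kkt: "kkt x' y1" "kkt x' y2"
    and H1: "H1 \<noteq> bot" "H1 \<le> sequentially" "\<And>w. ((\<lambda>k. c (Suc k) \<bullet> w) \<longlongrightarrow> y1 \<bullet> w) H1"
    and H2: "H2 \<noteq> bot" "H2 \<le> sequentially" "\<And>w. ((\<lambda>k. c (Suc k) \<bullet> w) \<longlongrightarrow> y2 \<bullet> w) H2"
  shows "y1 = y2"
proof -
  obtain l1 l2 where l: "energy x' y1 \<longlonglongrightarrow> l1" "energy x' y2 \<longlonglongrightarrow> l2"
    using energy_convergent kkt unfolding convergent_def by blast
  define z where "z = (y1 - y2) + s *\<^sub>R K (Ks (y1 - y2))"
  have inner_z: "w \<bullet> z = w \<bullet> (y1 - y2) + s * (Ks w \<bullet> Ks (y1 - y2))" for w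
    by (simp add: z_def inner_add_right inner_commute[of w "K _"] adj inner_commute[of "Ks w"])
  have cz: "c k \<bullet> z = (energy x' y2 k - energy x' y1 k - gsq y2 + gsq y1) / 2" for k
    unfolding inner_z energy_def gsq_def Ks.diff power2_norm_eq_inner
    by (simp add: inner_diff_left inner_diff_right inner_commute algebra_simps)
  have "(\<lambda>k. c k \<bullet> z) \<longlonglongrightarrow> (l2 - l1 - gsq y2 + gsq y1) / 2"
    unfolding cz by (intro tendsto_intros l) auto
  then have "(\<lambda>k. c (Suc k) \<bullet> z) \<longlonglongrightarrow> (l2 - l1 - gsq y2 + gsq y1) / 2"
    by (rule LIMSEQ_Suc)
  then have "y1 \<bullet> z = (l2 - l1 - gsq y2 + gsq y1) / 2" "y2 \<bullet> z = (l2 - l1 - gsq y2 + gsq y1) / 2"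
    using tendsto_unique[OF H1(1) H1(3)] tendsto_unique[OF H2(1) H2(3)] tendsto_mono[OF H1(2)] tendsto_mono[OF H2(2)]
    by blast+
  then have "(y1 - y2) \<bullet> z = 0" by (simp add: inner_diff_left)
  then have "gsq (y1 - y2) = 0" unfolding inner_z by (simp add: gsq_def power2_norm_eq_inner)
  then show ?thesis using norm_sq_le_gsq[of "y1 - y2"] by simp
qed

text \<open>If \<open>c\<^sub>k \<bullet> w\<close> stayed away from its expected limit on an infinite set \<open>S\<close> of indices, a cluster point along
\<open>S\<close> would differ from \<open>y'\<close>. The shift by \<open>s K u\<close> vanishes in the limit.\<close>

lemma dual_weakly_convergent:
  assumes kkt: "kkt x' y0"
  obtains y' where "kkt x' y'" "\<And>w. (\<lambda>k. (c (Suc k) + s *\<^sub>R K (u k)) \<bullet> w) \<longlonglongrightarrow> y' \<bullet> w"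
proof -
  obtain B where B: "\<And>k. norm (c k) \<le> B" using c_bounded[OF kkt] by blast
  obtain H y' where H: "H \<le> sequentially" "H \<noteq> bot" "\<And>w. ((\<lambda>k. c (Suc k) \<bullet> w) \<longlongrightarrow> y' \<bullet> w) H"
    using bounded_weak_cluster_point[of sequentially "\<lambda>k. c (Suc k)" B] B by auto
  have y': "kkt x' y'" using weak_cluster_point_kkt[OF kkt H(2,1,3)] .
  have lim: "(\<lambda>k. c (Suc k) \<bullet> w) \<longlonglongrightarrow> y' \<bullet> w" for w
  proof (rule ccontr)
    assume "\<not> ?thesis"
    then obtain e where e: "e > 0" "\<not> eventually (\<lambda>k. dist (c (Suc k) \<bullet> w) (y' \<bullet> w) < e) sequentially"
      unfolding tendsto_iff by blast
    define S where "S = {k. \<not> dist (c (Suc k) \<bullet> w) (y' \<bullet> w) < e}"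
    have "inf sequentially (principal S) \<noteq> bot"
      using e(2) by (simp add: trivial_limit_def eventually_inf_principal S_def)
    then obtain H' y'' where H': "H' \<le> inf sequentially (principal S)" "H' \<noteq> bot"
        "\<And>w. ((\<lambda>k. c (Suc k) \<bullet> w) \<longlongrightarrow> y'' \<bullet> w) H'"
      using bounded_weak_cluster_point[of "inf sequentially (principal S)" "\<lambda>k. c (Suc k)" B] B by auto
    have le: "H' \<le> sequentially" using H'(1) by simp
    have "kkt x' y''" using weak_cluster_point_kkt[OF kkt H'(2) le H'(3)] .
    then have "y'' = y'" using weak_cluster_point_unique[OF _ y' H'(2) le H'(3) H(2,1,3)] by blast
    then have "eventually (\<lambda>k. dist (c (Suc k) \<bullet> w) (y' \<bullet> w) < e) H'"
      using H'(3) e(1) by (auto simp: tendsto_iff)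
    moreover have "eventually (\<lambda>k. k \<in> S) H'"
      using H'(1) by (simp add: le_principal)
    ultimately have "eventually (\<lambda>_. False) H'" by eventually_elim (simp add: S_def)
    then show False using H'(2) by (simp add: trivial_limit_def)
  qed
  have "(\<lambda>k. (c (Suc k) + s *\<^sub>R K (u k)) \<bullet> w) \<longlonglongrightarrow> y' \<bullet> w" for w
  proof -
    have "(\<lambda>k. c (Suc k) \<bullet> w + s * (K (u k) \<bullet> w)) \<longlonglongrightarrow> y' \<bullet> w + s * (K 0 \<bullet> w)"
      by (intro tendsto_intros lim K.tendsto u_tendsto_0[OF kkt])
    then show ?thesis by (simp add: inner_add_left)
  qed
  then show ?thesis using that y' by blast
qed

end

section \<open>From the Douglas-Rachford iteration to the preconditioned scheme\<close>

lemma inv_id_plus_normal_operator: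
  fixes K :: "'a::{real_inner, complete_space} \<Rightarrow> 'b::real_inner" and b :: 'a
  assumes K: "bounded_linear K" and s: "s \<ge> 0"
  defines "u \<equiv> inv (\<lambda>u. u + s *\<^sub>R adjoint K (K u)) b"
  shows "u + s *\<^sub>R adjoint K (K u) = b"
proof -
  have "\<exists>u. b = u + s *\<^sub>R adjoint K (K u)" for b
  proof -
    have "bounded_linear (\<lambda>w. b \<bullet> w)" by (rule bounded_linear_inner_right)
    then obtain u where u: "\<And>w. u \<bullet> w + s * (K u \<bullet> K w) = b \<bullet> w"
      using energy_riesz[OF K _ s, of "\<lambda>w. b \<bullet> w"] by blast
    have "(u + s *\<^sub>R adjoint K (K u)) \<bullet> w = b \<bullet> w" for w
    proof -
      have "adjoint K (K u) \<bullet> w = K u \<bullet> K w"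
        using inner_adjoint_hilbert[OF K, of w "K u"] by (simp add: inner_commute)
      then show ?thesis using u[of w] by (simp add: inner_add_left)
    qed
    then have "u + s *\<^sub>R adjoint K (K u) = b" by (subst vector_eq_rdot[symmetric]) simp
    then show ?thesis by blast
  qed
  then have "surj (\<lambda>u. u + s *\<^sub>R adjoint K (K u))" unfolding surj_def by blast
  then show ?thesis unfolding u_def by (rule surj_f_inv_f)
qed

text \<open>The two equations for \<open>x\<close> and \<open>y\<close> hold up to one defect \<open>D = y - (c' + \<tau> K (a - a'))\<close>: the defining equation of
\<open>a'\<close> shows that \<open>x\<close> is off by \<open>\<sigma> K\<^sup>* D\<close>, and the formula for \<open>yh'\<close> then yields \<open>D + \<sigma> \<tau> K K\<^sup>* D = 0\<close>,
so that \<open>D\<close> vanishes by positivity. The primed objects are those of the next index, whose step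
sizes are \<open>\<theta> \<sigma>\<close> and \<open>\<tau> / \<theta>\<close>.\<close>

lemma aDR_step_preconditioned:
  fixes K :: "'a::real_inner \<Rightarrow> 'b::real_inner"
  assumes K: "bounded_linear K" and Ks: "bounded_linear Ks" and adj: "\<And>x y. K x \<bullet> y = x \<bullet> Ks y"
    and pos: "\<sigma> > 0" "\<tau> > 0" "\<theta> > 0"
    and a: "a + (\<sigma> * \<tau>) *\<^sub>R Ks (K a) = xh + \<sigma> *\<^sub>R Ks yh" and c: "c = yh - \<tau> *\<^sub>R K a"
    and d: "d + (\<sigma> * \<tau>) *\<^sub>R Ks (K d)
      = ((1 + \<theta>) *\<^sub>R x - \<theta> *\<^sub>R xh) - \<sigma> *\<^sub>R Ks ((1 + \<theta>) *\<^sub>R y - yh)"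
    and xh': "xh' = \<theta> *\<^sub>R (xh - x) + d" and yh': "yh' = y + (inverse \<theta> * \<tau>) *\<^sub>R K d"
    and a': "a' + (\<sigma> * \<tau>) *\<^sub>R Ks (K a') = xh' + (\<theta> * \<sigma>) *\<^sub>R Ks yh'"
    and c': "c' = yh' - (inverse \<theta> * \<tau>) *\<^sub>R K a'"
  shows "xh = a - \<sigma> *\<^sub>R Ks c" "x = a' - \<sigma> *\<^sub>R Ks (c - c')" "y = c' + \<tau> *\<^sub>R K (a - a')"
proof -
  interpret K: bounded_linear K by (rule K)
  interpret Ks: bounded_linear Ks by (rule Ks)
  show xh: "xh = a - \<sigma> *\<^sub>R Ks c"
    using a by (simp add: c Ks.diff Ks.scaleR algebra_simps)
  have st: "(\<theta> * \<sigma>) * (inverse \<theta> * \<tau>) = \<sigma> * \<tau>" using pos by simp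
  define D where "D = y - (c' + \<tau> *\<^sub>R K (a - a'))"
  have yh: "yh = c + \<tau> *\<^sub>R K a" using c by simp
  have y: "y = D + c' + \<tau> *\<^sub>R K (a - a')" by (simp add: D_def)
  have "xh' + (\<theta> * \<sigma>) *\<^sub>R Ks yh' = \<theta> *\<^sub>R (xh - x) + (d + (\<sigma> * \<tau>) *\<^sub>R Ks (K d)) + (\<theta> * \<sigma>) *\<^sub>R Ks y"
    unfolding xh' yh' by (simp add: Ks.add Ks.scaleR scaleR_add_right) (use pos in simp)
  also have "\<dots> = x + \<sigma> *\<^sub>R Ks (yh - y)"
    unfolding d by (simp add: Ks.add Ks.diff Ks.scaleR algebra_simps)
  finally have 1: "a' + (\<sigma> * \<tau>) *\<^sub>R Ks (K a') = x + \<sigma> *\<^sub>R Ks (yh - y)" using a' by simp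
  have yhy: "yh - y = (c - c') + \<tau> *\<^sub>R K a' - D" unfolding y yh K.diff by (simp add: algebra_simps)
  have x: "x = a' - \<sigma> *\<^sub>R Ks (c - c') + \<sigma> *\<^sub>R Ks D"
    using 1 unfolding yhy by (simp add: Ks.add Ks.diff Ks.scaleR algebra_simps)
  have "xh' = a' - (\<theta> * \<sigma>) *\<^sub>R Ks c'"
    using a' by (simp add: c' Ks.diff Ks.scaleR algebra_simps) (use pos in simp)
  then have "a' - d = \<theta> *\<^sub>R (xh - x + \<sigma> *\<^sub>R Ks c')" unfolding xh' by (simp add: algebra_simps)
  then have "(inverse \<theta> * \<tau>) *\<^sub>R K (a' - d) = \<tau> *\<^sub>R K (xh - x + \<sigma> *\<^sub>R Ks c')"
    using pos by (simp add: K.scaleR)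
  moreover have "y - c' = (inverse \<theta> * \<tau>) *\<^sub>R K (a' - d)"
    unfolding c' yh' K.diff by (simp add: algebra_simps)
  moreover have "xh - x + \<sigma> *\<^sub>R Ks c' = (a - a') - \<sigma> *\<^sub>R Ks D"
    unfolding xh x Ks.diff by (simp add: algebra_simps)
  ultimately have "y - c' = \<tau> *\<^sub>R K ((a - a') - \<sigma> *\<^sub>R Ks D)" by simp
  also have "\<dots> = \<tau> *\<^sub>R K (a - a') - (\<sigma> * \<tau>) *\<^sub>R K (Ks D)"
    unfolding K.diff[of _ "\<sigma> *\<^sub>R Ks D"] K.scaleR by (simp add: scaleR_diff_right mult.commute)
  finally have "D = - ((\<sigma> * \<tau>) *\<^sub>R K (Ks D))" unfolding y by simp
  then have "D \<bullet> D = - (\<sigma> * \<tau>) * (K (Ks D) \<bullet> D)"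
    by (metis inner_minus_left inner_scaleR_left mult_minus_left)
  then have "D \<bullet> D \<le> 0" using pos by (simp add: adj)
  then have "D \<bullet> D = 0" by (intro antisym) auto
  then have D: "D = 0" by simp
  show "x = a' - \<sigma> *\<^sub>R Ks (c - c')" using x by (simp add: D Ks.zero)
  show "y = c' + \<tau> *\<^sub>R K (a - a')" using y by (simp add: D)
qed

theorem proposition5:
  fixes K :: "'a::{real_inner, complete_space} \<Rightarrow> 'b::{real_inner, complete_space}"
    and F :: "'a \<Rightarrow> ereal" and G :: "'b \<Rightarrow> ereal"
    and \<gamma>1 \<gamma> :: real and \<sigma> \<tau> \<theta> :: "nat \<Rightarrow> real"
    and x b d xh :: "nat \<Rightarrow> 'a" and y yh :: "nat \<Rightarrow> 'b"
  assumes "bounded_linear K"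
    and "proper_fun F" "convex_fun F" "lsc_fun F"
    and "proper_fun G" "convex_fun G" "lsc_fun G"
    and "\<gamma>1 > 0" "strongly_convex_fun \<gamma>1 F"
    and "\<exists>x0 y0. saddle_point K F G x0 y0"
    and "\<sigma> 0 > 0" "\<tau> 0 > 0"
    and "0 < \<gamma>" "\<gamma> < 2 * \<gamma>1 / (1 + \<sigma> 0 * \<tau> 0 * (onorm K)\<^sup>2)"
    and "aDR_iteration K F G \<gamma> \<sigma> \<tau> \<theta> x y b d xh yh"
  shows "\<exists>xs ys. saddle_point K F G xs ys \<and>
           x \<longlonglongrightarrow> xs \<and>
           (\<lambda>k. (norm (x k - xs))\<^sup>2) \<in> O(\<lambda>k. 1 / (real k)\<^sup>2) \<and>
           weakly_tendsto y ys \<and>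
           (\<forall>x' y'. saddle_point K F G x' y' \<longrightarrow> x' = xs)"
proof -
  note K = assms(1)
  have \<theta>_0: "\<theta> 0 = 1 / sqrt (1 + \<sigma> 0 * \<gamma>)"
    and x_Suc: "x (Suc k) = resolvent (\<sigma> k) (subdiff F) (xh k)"
    and y_Suc: "y (Suc k) = resolvent (\<tau> k) (subdiff G) (yh k)"
    and b_Suc: "b (Suc k) = ((1 + \<theta> k) *\<^sub>R x (Suc k) - \<theta> k *\<^sub>R xh k)
      - \<sigma> k *\<^sub>R adjoint K ((1 + \<theta> k) *\<^sub>R y (Suc k) - yh k)"
    and d_Suc: "d (Suc k) = inv (\<lambda>u. u + (\<sigma> 0 * \<tau> 0) *\<^sub>R adjoint K (K u)) (b (Suc k))"
    and xh_Suc: "xh (Suc k) = \<theta> k *\<^sub>R (xh k - x (Suc k)) + d (Suc k)"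
    and yh_Suc: "yh (Suc k) = y (Suc k) + (inverse (\<theta> k) * \<tau> k) *\<^sub>R K (d (Suc k))"
    and \<sigma>_Suc: "\<sigma> (Suc k) = \<theta> k * \<sigma> k"
    and \<tau>_Suc: "\<tau> (Suc k) = inverse (\<theta> k) * \<tau> k"
    and \<theta>_Suc: "\<theta> (Suc k) = 1 / sqrt (1 + \<sigma> (Suc k) * \<gamma>)" for k
    using assms(15) unfolding aDR_iteration_def by blast+
  define Ks where "Ks = adjoint K"
  define s where "s = \<sigma> 0 * \<tau> 0"
  have s: "s > 0" using assms(11,12) by (simp add: s_def)
  have adj: "K p \<bullet> q = p \<bullet> Ks q" and Ks: "bounded_linear Ks" and Ks_le: "norm (Ks q) \<le> onorm K * norm q" for p q
    unfolding Ks_def by (rule adjoint_hilbert[OF K])+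
  have \<theta>_eq: "\<theta> k = 1 / sqrt (1 + \<gamma> * \<sigma> k)" for k
    by (cases k) (simp_all only: \<theta>_0 \<theta>_Suc mult.commute)
  have \<sigma>: "\<sigma> k > 0" and st: "\<tau> k * \<sigma> k = s" for k
  proof (induction k)
    case 0
    show "\<sigma> 0 > 0" "\<tau> 0 * \<sigma> 0 = s" using assms(11) by (simp_all add: s_def mult.commute)
  next
    case (Suc k)
    then have "\<theta> k > 0" using \<open>0 < \<gamma>\<close> by (simp add: \<theta>_eq add_pos_pos)
    then show "\<sigma> (Suc k) > 0" "\<tau> (Suc k) * \<sigma> (Suc k) = s" using Suc by (simp_all add: \<sigma>_Suc \<tau>_Suc field_simps)
  qed
  have \<theta>: "\<theta> k > 0" for k using \<sigma>[of k] \<open>0 < \<gamma>\<close> by (simp add: \<theta>_eq add_pos_pos)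
  have \<tau>: "\<tau> k > 0" for k using \<sigma>[of k] st[of k] s zero_less_mult_pos2[of "\<tau> k" "\<sigma> k"] by simp
  have st': "\<sigma> k * \<tau> k = s" for k using st by (simp add: mult.commute)
  define a where "a k = inv (\<lambda>u. u + s *\<^sub>R Ks (K u)) (xh k + \<sigma> k *\<^sub>R Ks (yh k))" for k
  define c where "c k = yh k - \<tau> k *\<^sub>R K (a k)" for k
  define u where "u k = (1 / \<sigma> k) *\<^sub>R (a k - a (Suc k))" for k
  define v where "v k = (1 / \<tau> k) *\<^sub>R (c k - c (Suc k))" for k
  have a_eq: "a k + s *\<^sub>R Ks (K (a k)) = xh k + \<sigma> k *\<^sub>R Ks (yh k)" for k
    unfolding a_def Ks_def by (rule inv_id_plus_normal_operator[OF K]) (use s in simp)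
  have d_eq: "d (Suc k) + s *\<^sub>R Ks (K (d (Suc k))) = b (Suc k)" for k
    unfolding d_Suc Ks_def s_def
    by (rule inv_id_plus_normal_operator[OF K]) (use s in \<open>simp add: s_def\<close>)
  have u: "a k - a (Suc k) = \<sigma> k *\<^sub>R u k" and v: "c k - c (Suc k) = \<tau> k *\<^sub>R v k" for k
    using \<sigma>[of k] \<tau>[of k] by (simp_all add: u_def v_def)
  interpret K: bounded_linear K by (rule K)
  interpret Ks: bounded_linear Ks by (rule Ks)
  have xh: "xh k = a k - \<sigma> k *\<^sub>R Ks (c k)" and x: "x (Suc k) = a (Suc k) - s *\<^sub>R Ks (v k)"
    and y: "y (Suc k) = c (Suc k) + s *\<^sub>R K (u k)" for k
  proof -
    note step = aDR_step_preconditioned[OF K Ks adj \<sigma>[of k] \<tau>[of k] \<theta>[of k], unfolded st',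
        OF a_eq[of k] c_def[of k] d_eq[of k, unfolded b_Suc, folded Ks_def] xh_Suc yh_Suc
          a_eq[of "Suc k", unfolded \<sigma>_Suc] c_def[of "Suc k", unfolded \<tau>_Suc]]
    show "xh k = a k - \<sigma> k *\<^sub>R Ks (c k)" by (rule step(1))
    show "x (Suc k) = a (Suc k) - s *\<^sub>R Ks (v k)"
      using step(2) unfolding v Ks.scaleR scaleR_scaleR st' .
    show "y (Suc k) = c (Suc k) + s *\<^sub>R K (u k)"
      using step(3) unfolding u K.scaleR scaleR_scaleR st .
  qed
  \<comment> \<open>the subgradients \<open>(xh\<^sub>k - x\<^sub>k\<^sub>+\<^sub>1) / \<sigma>\<^sub>k\<close> and \<open>(yh\<^sub>k - y\<^sub>k\<^sub>+\<^sub>1) / \<tau>\<^sub>k\<close> provided by the resolvents, in the new variables\<close>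
  interpret S: accelerated_proximal_scheme K Ks F G \<gamma>1 \<gamma> s \<sigma> \<tau> a u c v
  proof
    show "\<gamma> * (1 + s * (onorm K)\<^sup>2) < 2 * \<gamma>1"
      using assms(14) s by (simp add: less_divide_eq add_pos_nonneg flip: s_def)
    show "\<sigma> (Suc k) = \<sigma> k / sqrt (1 + \<gamma> * \<sigma> k)" for k by (simp add: \<sigma>_Suc \<theta>_eq)
    show "a k = a (Suc k) + \<sigma> k *\<^sub>R u k" "c k = c (Suc k) + \<tau> k *\<^sub>R v k" for k
      by (simp_all only: u[symmetric] v[symmetric]) simp_all
    fix k
    have "(1 / \<sigma> k) *\<^sub>R (xh k - x (Suc k)) \<in> subdiff F (x (Suc k))"
      using resolvent_subdiff[OF assms(2,3,4) \<sigma>[of k], of "xh k"] unfolding x_Suc .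
    also have "xh k - x (Suc k) = \<sigma> k *\<^sub>R u k - \<sigma> k *\<^sub>R Ks (c k) + s *\<^sub>R Ks (v k)"
      unfolding xh x u[symmetric] by simp
    also have "c k = c (Suc k) + \<tau> k *\<^sub>R v k" unfolding v[symmetric] by simp
    also have "\<sigma> k *\<^sub>R u k - \<sigma> k *\<^sub>R Ks (c (Suc k) + \<tau> k *\<^sub>R v k) + s *\<^sub>R Ks (v k) = \<sigma> k *\<^sub>R (u k - Ks (c (Suc k)))"
      unfolding Ks.add Ks.scaleR scaleR_add_right scaleR_scaleR st' by (simp add: scaleR_diff_right)
    finally show "u k - Ks (c (Suc k)) \<in> subdiff F (a (Suc k) - s *\<^sub>R Ks (v k))"
      using \<sigma>[of k] unfolding x by simp
    have "(1 / \<tau> k) *\<^sub>R (yh k - y (Suc k)) \<in> subdiff G (y (Suc k))"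
      using resolvent_subdiff[OF assms(5,6,7) \<tau>[of k], of "yh k"] unfolding y_Suc .
    also have "yh k - y (Suc k) = (c k - c (Suc k)) + \<tau> k *\<^sub>R K (a k) - s *\<^sub>R K (u k)"
      unfolding y c_def[of k] by simp
    also have "\<dots> = \<tau> k *\<^sub>R v k + \<tau> k *\<^sub>R K (a (Suc k) + \<sigma> k *\<^sub>R u k) - s *\<^sub>R K (u k)"
      unfolding v u[symmetric] by simp
    also have "\<dots> = \<tau> k *\<^sub>R (v k + K (a (Suc k)))"
      unfolding K.add K.scaleR scaleR_add_right scaleR_scaleR st by simp
    finally show "v k + K (a (Suc k)) \<in> subdiff G (c (Suc k) + s *\<^sub>R K (u k))"
      using \<tau>[of k] unfolding y by simp
  qed (rule assms K Ks adj Ks_le s st)+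
  have saddle_iff: "saddle_point K F G x' y' \<longleftrightarrow> S.kkt x' y'" for x' y'
    unfolding S.kkt_def by (rule saddle_point_iff_subdiff[OF adj assms(2,5)])
  obtain xs y0 where kkt: "S.kkt xs y0" using assms(10) saddle_iff by blast
  obtain ys where ys: "S.kkt xs ys" and weak: "\<And>w. (\<lambda>k. y (Suc k) \<bullet> w) \<longlonglongrightarrow> ys \<bullet> w"
    by (rule S.dual_weakly_convergent[OF kkt]) (simp add: y)
  have x_lim: "x \<longlonglongrightarrow> x'" if "S.kkt x' y'" for x' y'
    using S.primal_tendsto[OF that] unfolding x[symmetric] by (rule filterlim_sequentially_Suc[THEN iffD1])
  obtain C where "eventually (\<lambda>k. (norm (x (Suc k) - xs))\<^sup>2 \<le> C / (real (Suc k))\<^sup>2) sequentially"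
    using S.primal_rate[OF ys] unfolding x by (elim exE)
  then have "eventually (\<lambda>k. (norm (x k - xs))\<^sup>2 \<le> C / (real k)\<^sup>2) sequentially"
    by (subst (asm) eventually_sequentially_Suc)
  then have rate: "(\<lambda>k. (norm (x k - xs))\<^sup>2) \<in> O(\<lambda>k. 1 / (real k)\<^sup>2)"
    by (intro bigoI[where c = C]) simp
  have weak': "weakly_tendsto y ys"
    unfolding weakly_tendsto_def
  proof (intro allI impI)
    fix f :: "'b \<Rightarrow> real" assume "bounded_linear f"
    then obtain w where w: "\<And>z. f z = w \<bullet> z" by (rule riesz_representation) (rule that)
    have "(\<lambda>k. y k \<bullet> w) \<longlonglongrightarrow> ys \<bullet> w"
      using weak[of w] by (rule filterlim_sequentially_Suc[THEN iffD1])
    then show "(\<lambda>k. f (y k)) \<longlonglongrightarrow> f ys" by (simp add: w inner_commute)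
  qed
  have unique: "\<forall>x' y'. saddle_point K F G x' y' \<longrightarrow> x' = xs"
    unfolding saddle_iff using LIMSEQ_unique[OF x_lim x_lim[OF ys]] by blast
  have "saddle_point K F G xs ys" unfolding saddle_iff by (rule ys)
  then show ?thesis
    using x_lim[OF ys] rate weak' unique by (intro exI conjI)
qed

end
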